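(* Let $\mathcal{D}=(G,\chi,a,\alpha)$ be a datum. Let $\mathcal{H}=(H_{\mathcal{D}},\cdot,\mathbin{:})$ be a Hopf $q$-brace structure on $H_{\mathcal{D}}$ such that $x\cdot x\ne0$ and $x\mathbin{:}x\ne0$, let $\lambda_{10}\in\mathds{k}^{\times}$ be the scalar such that $x\cdot x=\lambda_{10}(1-a)$, and let $s\colon H_{\mathcal{D}}\otimes H_{\mathcal{D}}\to H_{\mathcal{D}}\otimes H_{\mathcal{D}}$ be the weak braiding operator associated with $\mathcal{H}$. Then, for all $h,g\in G$, $$s(h\otimes gx)=\chi(h^g)({}^hg)x\otimes h^g,\qquad s(hx\otimes g)=\chi^{-1}(g)\,{}^hg\otimes(h^g)x,$$ and $$s(hx\otimes gx)=\lambda_{10}\chi^{-1}(g)\,{}^hg\otimes(h^g)(a-1)+\chi(h^g)\chi^{-1}(ga)({}^hg)x\otimes(h^g)x+\lambda_{10}\chi^{-1}(g)({}^hg)(a-1)\otimes(h^g)a.$$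
   Context: $\mathds{k}$ is an algebraically closed field of characteristic zero. Sweedler notation is used. The operations $x^y$ and ${}^xy$ (defined below) have highest precedence, then multiplication, then $\cdot$ and $\mathbin{:}$, then $+$ and $-$. Rank one pointed Hopf algebras. A datum $\mathcal{D}=(G,\chi,a,\alpha)$ consists of a finite group $G$, a character $\chi\colon G\to\mathds{k}^{\times}$, a central element $a\in G$ and $\alpha\in\mathds{k}$ such that, denoting by $n$ the order of $\chi(a)$, one has $n>1$ and ($\alpha(a^n-1)=0$ in $\mathds{k}[G]$ or $\chi^n=1$). $H_{\mathcal{D}}$ is the Hopf algebra generated as an algebra by $G$ and $x$, subject to the group relations of $G$, $x^n=\alpha(a^n-1)$ and $xg=\chi(g)gx$ for $g\in G$, with $\Delta(x)=x\otimes a+1\otimes x$, $\Delta(g)=g\otimes g$ (so $\epsilon(g)=1$, $\epsilon(x)=0$). It has $\mathds{k}$-basis $\{gx^m: g\in G,\ 0\le m<n\}$. Hopf $q$-braces. Let $X$ be a coalgebra and $p,d\colon X\otimes X\to X$ linear maps with $\epsilon\circ p=\epsilon\circ d=\epsilon\otimes\epsilon$; write $x\cdot y=p(x\otimes y)$, $x\mathbin{:}y=d(x\otimes y)$. $(X,\cdot,\mathbin{:})$ is a $q$-magma coalgebra if the map $X\otimes X^{\mathrm{cop}}\to X^{\mathrm{cop}}\otimes X$, $x\otimes y\mapsto y_{(1)}\mathbin{:}x_{(2)}\otimes x_{(1)}\cdot y_{(2)}$, is a coalgebra morphism. It is left regular if $\overline{G}(x\otimes y)=x\cdot y_{(1)}\otimes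 y_{(2)}$ is bijective on $X\otimes X$, right regular if $x\otimes y\mapsto x\mathbin{:}y_{(2)}\otimes y_{(1)}$ is bijective, and regular if it is both. A $q$-cycle coalgebra is a left regular $q$-magma coalgebra such that for all $u,v,w$: $(u\cdot v_{(1)})\cdot(w\mathbin{:}v_{(2)})=(u\cdot w_{(2)})\cdot(v\cdot w_{(1)})$, $(u\cdot v_{(1)})\mathbin{:}(w\cdot v_{(2)})=(u\mathbin{:}w_{(2)})\cdot(v\mathbin{:}w_{(1)})$, $(u\mathbin{:}v_{(1)})\mathbin{:}(w\mathbin{:}v_{(2)})=(u\mathbin{:}w_{(2)})\mathbin{:}(v\cdot w_{(1)})$. A Hopf $q$-brace is a Hopf algebra $H$ with a regular $q$-cycle coalgebra structure $(H,\cdot,\mathbin{:})$ such that $(H,\cdot)$ and $(H,\mathbin{:})$ are right $H^{\mathrm{op}}$-modules (i.e. $h\cdot 1=h$, $h\cdot kl=(h\cdot l)\cdot k$, and likewise for $\mathbin{:}$) and, for all $h,k,l\in H$, $hk\cdot l=(h\cdot(l_{(1)}\mathbin{:}k_{(2)}))(k_{(1)}\cdot l_{(2)})$ and $hk\mathbin{:}l=(h\mathbin{:}(l_{(1)}\cdot k_{(2)}))(k_{(1)}\mathbin{:}l_{(2)})$. Associated operations. $x^y:=(\mathrm{id}\otimes\epsilon)\overline{G}^{-1}(x\otimes y)$, so that $x\otimes y\mapsto x^y$ is the unique linear map satisfying $(x\cdot y_{(1)})^{y_{(2)}}=x^{y_{(1)}}\cdot y_{(2)}=\epsilon(y)x$;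 and ${}^xy:=y_{(2)}\mathbin{:}x^{y_{(1)}}$. The weak braiding operator associated with $\mathcal{H}$ is $(H_{\mathcal{D}},s)$ with $s(h\otimes l)={}^{h_{(1)}}l_{(1)}\otimes {h_{(2)}}^{l_{(2)}}$. For $h,g\in G$ one has $h^g,{}^hg\in G$. Known facts: for a Hopf $q$-brace on $H_{\mathcal{D}}$ with $x\cdot x\ne0$ and $x\mathbin{:}x\ne0$, one has $n=2$, $\chi^2=1$, $a\cdot g=a\mathbin{:}g=a$ and $g\cdot a=g\mathbin{:}a=g$ for $g\in G$, and there is $\lambda_{10}\in\mathds{k}^\times$ such that for all $h,g\in G$: $hx\cdot g=\chi(g)(h\cdot g)x$, $hx\mathbin{:}g=\chi(g)(h\mathbin{:}g)x$, $h\cdot gx=h\mathbin{:}gx=0$, $hx\cdot gx=\lambda_{10}(h\cdot g)(1-a)$, $hx\mathbin{:}gx=-\lambda_{10}(h\mathbin{:}g)(1-a)$. *)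

theory Defs
  imports
    "HOL-Library.Poly_Mapping"
    "HOL-Computational_Algebra.Polynomial"
    "HOL-Algebra.Multiplicative_Group"
begin

section \<open>Vector spaces with a chosen basis and their tensor products\<close>

text \<open>
  A vector space over \<open>'k\<close> is presented as the space of finitely supported functions on a
  basis \<open>B\<close> (every vector space is of this form). The tensor product of the spaces on \<open>B\<close>
  and \<open>C\<close> is then the space on \<open>B \<times> C\<close>.
\<close>

definition vs :: "'b set \<Rightarrow> ('b \<Rightarrow>\<^sub>0 'k::field) set" where
  "vs B = {v. Poly_Mapping.keys v \<subseteq> B}"

definition bas :: "'b \<Rightarrow> ('b \<Rightarrow>\<^sub>0 'k::field)" where
  "bas b = Poly_Mapping.single b 1"

definition scal :: "'k::field \<Rightarrow> ('b \<Rightarrow>\<^sub>0 'k) \<Rightarrow> ('b \<Rightarrow>\<^sub>0 'k)" (infixr "*\<^sub>k" 75) where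
  "c *\<^sub>k v = Poly_Mapping.map ((*) c) v"

definition lin_ext :: "('b \<Rightarrow> ('c \<Rightarrow>\<^sub>0 'k)) \<Rightarrow> ('b \<Rightarrow>\<^sub>0 'k::field) \<Rightarrow> ('c \<Rightarrow>\<^sub>0 'k)" where
  "lin_ext f v = (\<Sum>b\<in>Poly_Mapping.keys v. Poly_Mapping.lookup v b *\<^sub>k f b)"

definition tensor ::
  "('b \<Rightarrow>\<^sub>0 'k::field) \<Rightarrow> ('c \<Rightarrow>\<^sub>0 'k) \<Rightarrow> (('b \<times> 'c) \<Rightarrow>\<^sub>0 'k)" (infixr "\<otimes>\<^sub>k" 73) where
  "u \<otimes>\<^sub>k v = lin_ext (\<lambda>b. lin_ext (\<lambda>c. bas (b, c)) v) u"

text \<open>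
  \<open>tlift t F\<close> is the value at \<open>t\<close> of the linear map induced by the bilinear map \<open>F\<close>. With
  \<open>t = \<Delta>(v)\<close>, the term \<open>tlift t (\<lambda>v\<^sub>1 v\<^sub>2. F v\<^sub>1 v\<^sub>2)\<close> is the Sweedler expression
  \<open>F(v\<^sub>1, v\<^sub>2)\<close>, summation understood.
\<close>

definition tlift :: "(('b \<times> 'c) \<Rightarrow>\<^sub>0 'k::field) \<Rightarrow>
    (('b \<Rightarrow>\<^sub>0 'k) \<Rightarrow> ('c \<Rightarrow>\<^sub>0 'k) \<Rightarrow> ('d \<Rightarrow>\<^sub>0 'k)) \<Rightarrow> ('d \<Rightarrow>\<^sub>0 'k)" where
  "tlift t F = lin_ext (\<lambda>(b, c). F (bas b) (bas c)) t"

definition linear_on :: "'b set \<Rightarrow> 'c set \<Rightarrow> (('b \<Rightarrow>\<^sub>0 'k::field) \<Rightarrow> ('c \<Rightarrow>\<^sub>0 'k)) \<Rightarrow> bool" where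
  "linear_on B C f \<longleftrightarrow>
     (\<forall>v\<in>vs B. f v \<in> vs C) \<and>
     (\<forall>u\<in>vs B. \<forall>v\<in>vs B. f (u + v) = f u + f v) \<and>
     (\<forall>c. \<forall>v\<in>vs B. f (c *\<^sub>k v) = c *\<^sub>k f v)"

definition linear_form_on :: "'b set \<Rightarrow> (('b \<Rightarrow>\<^sub>0 'k::field) \<Rightarrow> 'k) \<Rightarrow> bool" where
  "linear_form_on B f \<longleftrightarrow>
     (\<forall>u\<in>vs B. \<forall>v\<in>vs B. f (u + v) = f u + f v) \<and>
     (\<forall>c. \<forall>v\<in>vs B. f (c *\<^sub>k v) = c * f v)"


section \<open>Coalgebras and Hopf algebras\<close>

record (overloaded) ('b, 'k) coalg =
  cbasis :: "'b set"
  comult :: "('b \<Rightarrow>\<^sub>0 'k::field) \<Rightarrow> (('b \<times> 'b) \<Rightarrow>\<^sub>0 'k)"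
  counit :: "('b \<Rightarrow>\<^sub>0 'k) \<Rightarrow> 'k"

record (overloaded) ('b, 'k) bialg = "('b, 'k::field) coalg" +
  product :: "(('b \<times> 'b) \<Rightarrow>\<^sub>0 'k) \<Rightarrow> ('b \<Rightarrow>\<^sub>0 'k)"
  unity :: "'b \<Rightarrow>\<^sub>0 'k"

abbreviation csp :: "('b, 'k::field, 'z) coalg_scheme \<Rightarrow> ('b \<Rightarrow>\<^sub>0 'k) set" where
  "csp C \<equiv> vs (cbasis C)"

definition pmult :: "('b, 'k::field, 'z) bialg_scheme \<Rightarrow> ('b \<Rightarrow>\<^sub>0 'k) \<Rightarrow> ('b \<Rightarrow>\<^sub>0 'k) \<Rightarrow> ('b \<Rightarrow>\<^sub>0 'k)"
    (infixl "\<star>\<index>" 76) where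
  "u \<star>\<^bsub>H\<^esub> v = product H (u \<otimes>\<^sub>k v)"

definition coalgebra :: "('b, 'k::field, 'z) coalg_scheme \<Rightarrow> bool" where
  "coalgebra C \<longleftrightarrow>
     linear_on (cbasis C) (cbasis C \<times> cbasis C) (comult C) \<and>
     linear_form_on (cbasis C) (counit C) \<and>
     (\<forall>v\<in>csp C.
        tlift (comult C v) (\<lambda>v1 v2. tlift (comult C v1) (\<lambda>v11 v12. v11 \<otimes>\<^sub>k v12 \<otimes>\<^sub>k v2)) =
        tlift (comult C v) (\<lambda>v1 v2. v1 \<otimes>\<^sub>k comult C v2)) \<and>
     (\<forall>v\<in>csp C. tlift (comult C v) (\<lambda>v1 v2. counit C v1 *\<^sub>k v2) = v) \<and>
     (\<forall>v\<in>csp C. tlift (comult C v) (\<lambda>v1 v2. counit C v2 *\<^sub>k v1) = v)"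

definition cop :: "('b, 'k::field, 'z) coalg_scheme \<Rightarrow> ('b, 'k) coalg" where
  "cop C = \<lparr> cbasis = cbasis C,
             comult = (\<lambda>v. tlift (comult C v) (\<lambda>v1 v2. v2 \<otimes>\<^sub>k v1)),
             counit = counit C \<rparr>"

definition tensor_coalg :: "('b, 'k::field, 'y) coalg_scheme \<Rightarrow> ('c, 'k, 'z) coalg_scheme \<Rightarrow>
    ('b \<times> 'c, 'k) coalg" where
  "tensor_coalg C D =
    \<lparr> cbasis = cbasis C \<times> cbasis D,
      comult = (\<lambda>t. tlift t (\<lambda>u v.
        tlift (comult C u) (\<lambda>u1 u2. tlift (comult D v) (\<lambda>v1 v2.
          (u1 \<otimes>\<^sub>k v1) \<otimes>\<^sub>k (u2 \<otimes>\<^sub>k v2))))),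
      counit = (\<lambda>t. \<Sum>(b, c)\<in>Poly_Mapping.keys t.
        Poly_Mapping.lookup t (b, c) * counit C (bas b) * counit D (bas c)) \<rparr>"

definition coalg_hom :: "('b, 'k::field, 'y) coalg_scheme \<Rightarrow> ('c, 'k, 'z) coalg_scheme \<Rightarrow>
    (('b \<Rightarrow>\<^sub>0 'k) \<Rightarrow> ('c \<Rightarrow>\<^sub>0 'k)) \<Rightarrow> bool" where
  "coalg_hom C D f \<longleftrightarrow>
     linear_on (cbasis C) (cbasis D) f \<and>
     (\<forall>v\<in>csp C. comult D (f v) = tlift (comult C v) (\<lambda>v1 v2. f v1 \<otimes>\<^sub>k f v2)) \<and>
     (\<forall>v\<in>csp C. counit D (f v) = counit C v)"

definition bialgebra :: "('b, 'k::field, 'z) bialg_scheme \<Rightarrow> bool" where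
  "bialgebra H \<longleftrightarrow>
     coalgebra H \<and>
     linear_on (cbasis H \<times> cbasis H) (cbasis H) (product H) \<and>
     unity H \<in> csp H \<and>
     (\<forall>u\<in>csp H. \<forall>v\<in>csp H. \<forall>w\<in>csp H. (u \<star>\<^bsub>H\<^esub> v) \<star>\<^bsub>H\<^esub> w = u \<star>\<^bsub>H\<^esub> (v \<star>\<^bsub>H\<^esub> w)) \<and>
     (\<forall>v\<in>csp H. unity H \<star>\<^bsub>H\<^esub> v = v \<and> v \<star>\<^bsub>H\<^esub> unity H = v) \<and>
     (\<forall>u\<in>csp H. \<forall>v\<in>csp H. comult H (u \<star>\<^bsub>H\<^esub> v) =
        tlift (comult H u) (\<lambda>u1 u2. tlift (comult H v) (\<lambda>v1 v2.
          (u1 \<star>\<^bsub>H\<^esub> v1) \<otimes>\<^sub>k (u2 \<star>\<^bsub>H\<^esub> v2)))) \<and>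
     comult H (unity H) = unity H \<otimes>\<^sub>k unity H \<and>
     (\<forall>u\<in>csp H. \<forall>v\<in>csp H. counit H (u \<star>\<^bsub>H\<^esub> v) = counit H u * counit H v) \<and>
     counit H (unity H) = 1"

definition hopf_algebra :: "('b, 'k::field, 'z) bialg_scheme \<Rightarrow> bool" where
  "hopf_algebra H \<longleftrightarrow>
     bialgebra H \<and>
     (\<exists>S. linear_on (cbasis H) (cbasis H) S \<and>
       (\<forall>v\<in>csp H.
          tlift (comult H v) (\<lambda>v1 v2. S v1 \<star>\<^bsub>H\<^esub> v2) = counit H v *\<^sub>k unity H \<and>
          tlift (comult H v) (\<lambda>v1 v2. v1 \<star>\<^bsub>H\<^esub> S v2) = counit H v *\<^sub>k unity H))"


section \<open>Hopf q-braces\<close>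

context
  fixes p d :: "(('b \<times> 'b) \<Rightarrow>\<^sub>0 'k::field) \<Rightarrow> ('b \<Rightarrow>\<^sub>0 'k)"
begin

private abbreviation (input) dot (infixl "\<cdot>" 74) where "u \<cdot> v \<equiv> p (u \<otimes>\<^sub>k v)"
private abbreviation (input) col (infixl "\<Colon>" 74) where "u \<Colon> v \<equiv> d (u \<otimes>\<^sub>k v)"

definition q_magma_coalgebra :: "('b, 'k, 'z) coalg_scheme \<Rightarrow> bool" where
  "q_magma_coalgebra X \<longleftrightarrow>
     coalgebra X \<and>
     linear_on (cbasis X \<times> cbasis X) (cbasis X) p \<and>
     linear_on (cbasis X \<times> cbasis X) (cbasis X) d \<and>
     (\<forall>u\<in>csp X. \<forall>v\<in>csp X. counit X (u \<cdot> v) = counit X u * counit X v) \<and>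
     (\<forall>u\<in>csp X. \<forall>v\<in>csp X. counit X (u \<Colon> v) = counit X u * counit X v) \<and>
     coalg_hom (tensor_coalg X (cop X)) (tensor_coalg (cop X) X)
       (\<lambda>t. tlift t (\<lambda>u v.
          tlift (comult X u) (\<lambda>u1 u2. tlift (comult X v) (\<lambda>v1 v2. (v1 \<Colon> u2) \<otimes>\<^sub>k (u1 \<cdot> v2)))))"

definition G_bar :: "('b, 'k, 'z) coalg_scheme \<Rightarrow> (('b \<times> 'b) \<Rightarrow>\<^sub>0 'k) \<Rightarrow> (('b \<times> 'b) \<Rightarrow>\<^sub>0 'k)" where
  "G_bar X t = tlift t (\<lambda>u v. tlift (comult X v) (\<lambda>v1 v2. (u \<cdot> v1) \<otimes>\<^sub>k v2))"

definition left_regular :: "('b, 'k, 'z) coalg_scheme \<Rightarrow> bool" where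
  "left_regular X \<longleftrightarrow>
     bij_betw (G_bar X) (vs (cbasis X \<times> cbasis X)) (vs (cbasis X \<times> cbasis X))"

definition right_regular :: "('b, 'k, 'z) coalg_scheme \<Rightarrow> bool" where
  "right_regular X \<longleftrightarrow>
     bij_betw (\<lambda>t. tlift t (\<lambda>u v. tlift (comult X v) (\<lambda>v1 v2. (u \<Colon> v2) \<otimes>\<^sub>k v1)))
       (vs (cbasis X \<times> cbasis X)) (vs (cbasis X \<times> cbasis X))"

definition q_cycle_coalgebra :: "('b, 'k, 'z) coalg_scheme \<Rightarrow> bool" where
  "q_cycle_coalgebra X \<longleftrightarrow>
     q_magma_coalgebra X \<and> left_regular X \<and>
     (\<forall>u\<in>csp X. \<forall>v\<in>csp X. \<forall>w\<in>csp X.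
        tlift (comult X v) (\<lambda>v1 v2. (u \<cdot> v1) \<cdot> (w \<Colon> v2)) =
        tlift (comult X w) (\<lambda>w1 w2. (u \<cdot> w2) \<cdot> (v \<cdot> w1)) \<and>
        tlift (comult X v) (\<lambda>v1 v2. (u \<cdot> v1) \<Colon> (w \<cdot> v2)) =
        tlift (comult X w) (\<lambda>w1 w2. (u \<Colon> w2) \<cdot> (v \<Colon> w1)) \<and>
        tlift (comult X v) (\<lambda>v1 v2. (u \<Colon> v1) \<Colon> (w \<Colon> v2)) =
        tlift (comult X w) (\<lambda>w1 w2. (u \<Colon> w2) \<Colon> (v \<cdot> w1)))"

definition hopf_q_brace :: "('b, 'k, 'z) bialg_scheme \<Rightarrow> bool" where
  "hopf_q_brace H \<longleftrightarrow>
     hopf_algebra H \<and> q_cycle_coalgebra H \<and> right_regular H \<and>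
     (\<forall>h\<in>csp H. h \<cdot> unity H = h \<and> h \<Colon> unity H = h) \<and>
     (\<forall>h\<in>csp H. \<forall>k\<in>csp H. \<forall>l\<in>csp H.
        h \<cdot> (k \<star>\<^bsub>H\<^esub> l) = (h \<cdot> l) \<cdot> k \<and>
        h \<Colon> (k \<star>\<^bsub>H\<^esub> l) = (h \<Colon> l) \<Colon> k \<and>
        (h \<star>\<^bsub>H\<^esub> k) \<cdot> l =
          tlift (comult H k) (\<lambda>k1 k2. tlift (comult H l) (\<lambda>l1 l2.
            (h \<cdot> (l1 \<Colon> k2)) \<star>\<^bsub>H\<^esub> (k1 \<cdot> l2))) \<and>
        (h \<star>\<^bsub>H\<^esub> k) \<Colon> l =
          tlift (comult H k) (\<lambda>k1 k2. tlift (comult H l) (\<lambda>l1 l2.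
            (h \<Colon> (l1 \<cdot> k2)) \<star>\<^bsub>H\<^esub> (k1 \<Colon> l2))))"

text \<open>\<open>right_exp X u v\<close> is \<open>u\<^sup>v\<close> and \<open>left_exp X u v\<close> is \<open>\<^sup>uv\<close>.\<close>

definition right_exp :: "('b, 'k, 'z) coalg_scheme \<Rightarrow> ('b \<Rightarrow>\<^sub>0 'k) \<Rightarrow> ('b \<Rightarrow>\<^sub>0 'k) \<Rightarrow> ('b \<Rightarrow>\<^sub>0 'k)" where
  "right_exp X u v =
     tlift (the_inv_into (vs (cbasis X \<times> cbasis X)) (G_bar X) (u \<otimes>\<^sub>k v))
       (\<lambda>w1 w2. counit X w2 *\<^sub>k w1)"

definition left_exp :: "('b, 'k, 'z) coalg_scheme \<Rightarrow> ('b \<Rightarrow>\<^sub>0 'k) \<Rightarrow> ('b \<Rightarrow>\<^sub>0 'k) \<Rightarrow> ('b \<Rightarrow>\<^sub>0 'k)" where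
  "left_exp X u v = tlift (comult X v) (\<lambda>v1 v2. v2 \<Colon> right_exp X u v1)"

definition weak_braiding ::
  "('b, 'k, 'z) coalg_scheme \<Rightarrow> (('b \<times> 'b) \<Rightarrow>\<^sub>0 'k) \<Rightarrow> (('b \<times> 'b) \<Rightarrow>\<^sub>0 'k)" where
  "weak_braiding X t = tlift t (\<lambda>u v.
     tlift (comult X u) (\<lambda>u1 u2. tlift (comult X v) (\<lambda>v1 v2.
       left_exp X u1 v1 \<otimes>\<^sub>k right_exp X u2 v2)))"

end


section \<open>Rank one pointed Hopf algebras\<close>

definition mult_order :: "'k::field \<Rightarrow> nat" where
  "mult_order q = (LEAST m. 0 < m \<and> q ^ m = 1)"

text \<open>The condition \<open>\<alpha>(a\<^sup>n - 1) = 0\<close> is an equation in the group algebra of \<open>G\<close>, that is, in the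
  space with basis \<open>G\<close>.\<close>

definition datum :: "('g, 'm) monoid_scheme \<Rightarrow> ('g \<Rightarrow> 'k::field) \<Rightarrow> 'g \<Rightarrow> 'k \<Rightarrow> bool" where
  "datum G \<chi> a \<alpha> \<longleftrightarrow>
     group G \<and> finite (carrier G) \<and>
     (\<forall>g\<in>carrier G. \<chi> g \<noteq> 0) \<and>
     (\<forall>g\<in>carrier G. \<forall>h\<in>carrier G. \<chi> (g \<otimes>\<^bsub>G\<^esub> h) = \<chi> g * \<chi> h) \<and>
     a \<in> carrier G \<and> (\<forall>g\<in>carrier G. a \<otimes>\<^bsub>G\<^esub> g = g \<otimes>\<^bsub>G\<^esub> a) \<and>
     mult_order (\<chi> a) > 1 \<and>
     (\<alpha> *\<^sub>k (bas (a [^]\<^bsub>G\<^esub> mult_order (\<chi> a)) - bas \<one>\<^bsub>G\<^esub>) = 0 \<or>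
      (\<forall>g\<in>carrier G. \<chi> g ^ mult_order (\<chi> a) = 1))"

text \<open>
  The algebra generated by \<open>G\<close> and \<open>x\<close> subject to the relations of \<open>G\<close>,
  \<open>x\<^sup>n = \<alpha>(a\<^sup>n - 1)\<close> and \<open>xg = \<chi>(g)gx\<close>, on its basis of monomials \<open>gx\<^sup>m\<close> with \<open>m < n\<close>; the
  basis vector \<open>gx\<^sup>m\<close> is indexed by \<open>(g, m)\<close>. The function below is the normal form of
  \<open>gx\<^sup>i \<cdot> hx\<^sup>j = \<chi>(h)\<^sup>i ghx\<^sup>i\<^sup>+\<^sup>j\<close>. That this is the presented algebra is proved below
  (\<open>H_mult_assoc\<close>, the relations, and the universal property \<open>H_universal\<close>).
\<close>

definition mono_mult :: "('g, 'm) monoid_scheme \<Rightarrow> ('g \<Rightarrow> 'k::field) \<Rightarrow> 'g \<Rightarrow> 'k \<Rightarrow>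
    'g \<times> nat \<Rightarrow> 'g \<times> nat \<Rightarrow> ('g \<times> nat \<Rightarrow>\<^sub>0 'k)" where
  "mono_mult G \<chi> a \<alpha> = (\<lambda>(g, i) (h, j).
     let n = mult_order (\<chi> a); gh = g \<otimes>\<^bsub>G\<^esub> h in
     if i + j < n then \<chi> h ^ i *\<^sub>k bas (gh, i + j)
     else \<chi> h ^ i *\<^sub>k \<alpha> *\<^sub>k (bas (gh \<otimes>\<^bsub>G\<^esub> a [^]\<^bsub>G\<^esub> n, i + j - n) - bas (gh, i + j - n)))"

definition grp :: "'g \<Rightarrow> ('g \<times> nat \<Rightarrow>\<^sub>0 'k::field)" where
  "grp g = bas (g, 0)"

definition gen_x :: "('g, 'm) monoid_scheme \<Rightarrow> ('g \<times> nat \<Rightarrow>\<^sub>0 'k::field)" where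
  "gen_x G = bas (\<one>\<^bsub>G\<^esub>, 1)"

definition H_prod :: "('g, 'm) monoid_scheme \<Rightarrow> ('g \<Rightarrow> 'k::field) \<Rightarrow> 'g \<Rightarrow> 'k \<Rightarrow>
    (('g \<times> nat) \<times> ('g \<times> nat) \<Rightarrow>\<^sub>0 'k) \<Rightarrow> ('g \<times> nat \<Rightarrow>\<^sub>0 'k)" where
  "H_prod G \<chi> a \<alpha> = lin_ext (\<lambda>(b, c). mono_mult G \<chi> a \<alpha> b c)"

text \<open>Multiplication of the algebra \<open>H \<otimes> H\<close>.\<close>

definition H2_mult :: "('g, 'm) monoid_scheme \<Rightarrow> ('g \<Rightarrow> 'k::field) \<Rightarrow> 'g \<Rightarrow> 'k \<Rightarrow>
    (('g \<times> nat) \<times> ('g \<times> nat) \<Rightarrow>\<^sub>0 'k) \<Rightarrow> (('g \<times> nat) \<times> ('g \<times> nat) \<Rightarrow>\<^sub>0 'k) \<Rightarrow>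
    (('g \<times> nat) \<times> ('g \<times> nat) \<Rightarrow>\<^sub>0 'k)" where
  "H2_mult G \<chi> a \<alpha> s t = tlift s (\<lambda>s1 s2. tlift t (\<lambda>t1 t2.
     H_prod G \<chi> a \<alpha> (s1 \<otimes>\<^sub>k t1) \<otimes>\<^sub>k H_prod G \<chi> a \<alpha> (s2 \<otimes>\<^sub>k t2)))"

text \<open>The comultiplication is the algebra map with \<open>\<Delta>(g) = g \<otimes> g\<close> and
  \<open>\<Delta>(x) = x \<otimes> a + 1 \<otimes> x\<close>, so \<open>\<Delta>(gx\<^sup>m) = (g \<otimes> g)(x \<otimes> a + 1 \<otimes> x)\<^sup>m\<close>.\<close>

definition H_comult :: "('g, 'm) monoid_scheme \<Rightarrow> ('g \<Rightarrow> 'k::field) \<Rightarrow> 'g \<Rightarrow> 'k \<Rightarrow>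
    ('g \<times> nat \<Rightarrow>\<^sub>0 'k) \<Rightarrow> (('g \<times> nat) \<times> ('g \<times> nat) \<Rightarrow>\<^sub>0 'k)" where
  "H_comult G \<chi> a \<alpha> = lin_ext (\<lambda>(g, m).
     ((\<lambda>t. H2_mult G \<chi> a \<alpha> t (gen_x G \<otimes>\<^sub>k grp a + grp \<one>\<^bsub>G\<^esub> \<otimes>\<^sub>k gen_x G)) ^^ m)
       (grp g \<otimes>\<^sub>k grp g))"

definition H_counit :: "('g \<times> nat \<Rightarrow>\<^sub>0 'k::field) \<Rightarrow> 'k" where
  "H_counit v = (\<Sum>(g, m)\<in>Poly_Mapping.keys v. if m = 0 then Poly_Mapping.lookup v (g, m) else 0)"

definition rank_one_hopf :: "('g, 'm) monoid_scheme \<Rightarrow> ('g \<Rightarrow> 'k::field) \<Rightarrow> 'g \<Rightarrow> 'k \<Rightarrow>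
    ('g \<times> nat, 'k) bialg" where
  "rank_one_hopf G \<chi> a \<alpha> =
    \<lparr> cbasis = carrier G \<times> {..<mult_order (\<chi> a)},
      comult = H_comult G \<chi> a \<alpha>,
      counit = H_counit,
      product = H_prod G \<chi> a \<alpha>,
      unity = grp \<one>\<^bsub>G\<^esub> \<rparr>"

subsection \<open>The algebra is the one presented by generators and relations\<close>

lemma lookup_scal [simp]: "Poly_Mapping.lookup (c *\<^sub>k v) b = c * Poly_Mapping.lookup v b"
  by (simp add: scal_def Poly_Mapping.map.rep_eq when_def)

lemma scal_simps [simp]:
  "c *\<^sub>k (u + v) = c *\<^sub>k u + c *\<^sub>k v" "c *\<^sub>k (u - v) = c *\<^sub>k u - c *\<^sub>k v"
  "c *\<^sub>k e *\<^sub>k v = (c * e) *\<^sub>k v" "1 *\<^sub>k v = v" "0 *\<^sub>k v = 0" "c *\<^sub>k 0 = 0"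
  by (auto intro!: poly_mapping_eqI simp: lookup_add lookup_minus algebra_simps)

lemma scal_add_left: "(c + e) *\<^sub>k v = c *\<^sub>k v + e *\<^sub>k v"
  by (auto intro!: poly_mapping_eqI simp: lookup_add algebra_simps)

lemma lin_ext_superset:
  assumes "finite S" "Poly_Mapping.keys v \<subseteq> S"
  shows "lin_ext f v = (\<Sum>b\<in>S. Poly_Mapping.lookup v b *\<^sub>k f b)"
  unfolding lin_ext_def using assms
  by (intro sum.mono_neutral_left) (auto simp: in_keys_iff)

lemma lin_ext_bas [simp]: "lin_ext f (bas b) = f b"
  by (simp add: lin_ext_def bas_def)

lemma lin_ext_zero [simp]: "lin_ext f 0 = 0"
  by (simp add: lin_ext_def)

lemma lin_ext_add [simp]: "lin_ext f (u + v) = lin_ext f u + lin_ext f v"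
proof -
  let ?S = "Poly_Mapping.keys u \<union> Poly_Mapping.keys v"
  have "lin_ext f w = (\<Sum>b\<in>?S. Poly_Mapping.lookup w b *\<^sub>k f b)" if "w \<in> {u, v, u + v}" for w
    using that keys_add[of u v] by (intro lin_ext_superset) auto
  thus ?thesis
    by (simp add: lookup_add scal_add_left sum.distrib)
qed

lemma scal_sum: "c *\<^sub>k (\<Sum>i\<in>I. f i) = (\<Sum>i\<in>I. c *\<^sub>k f i)"
  by (induction I rule: infinite_finite_induct) auto

lemma keys_scal: "Poly_Mapping.keys (c *\<^sub>k v) \<subseteq> Poly_Mapping.keys v"
  by (auto simp: in_keys_iff)

lemma lin_ext_scal [simp]: "lin_ext f (c *\<^sub>k v) = c *\<^sub>k lin_ext f v"
  by (subst lin_ext_superset[of "Poly_Mapping.keys v"])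
     (auto simp: keys_scal lin_ext_def scal_sum)

lemma lin_ext_diff [simp]: "lin_ext f (u - v) = lin_ext f u - lin_ext f v"
proof -
  have "lin_ext f u = lin_ext f (u - v) + lin_ext f v"
    unfolding lin_ext_add[symmetric] by simp
  thus ?thesis by simp
qed

lemma vs_induct [consumes 1, case_names zero scal add]:
  assumes "v \<in> vs B" "P 0" "\<And>c b. b \<in> B \<Longrightarrow> P (c *\<^sub>k bas b)"
    "\<And>u v. u \<in> vs B \<Longrightarrow> v \<in> vs B \<Longrightarrow> P u \<Longrightarrow> P v \<Longrightarrow> P (u + v)"
  shows "P v"
proof -
  have mem: "(\<Sum>b\<in>S. Poly_Mapping.lookup v b *\<^sub>k bas b) \<in> vs B \<and>
      P (\<Sum>b\<in>S. Poly_Mapping.lookup v b *\<^sub>k bas b)" if "finite S" "S \<subseteq> B" for S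
    using that
  proof (induction S rule: finite_induct)
    case empty
    show ?case using assms(2) by (simp add: vs_def)
  next
    case (insert b S)
    have "Poly_Mapping.lookup v b *\<^sub>k bas b \<in> vs B"
      using keys_scal[of "Poly_Mapping.lookup v b" "bas b"] insert.prems by (auto simp: vs_def bas_def)
    moreover from this have "Poly_Mapping.lookup v b *\<^sub>k bas b +
        (\<Sum>b\<in>S. Poly_Mapping.lookup v b *\<^sub>k bas b) \<in> vs B"
      using insert keys_add[of "Poly_Mapping.lookup v b *\<^sub>k bas b"
          "\<Sum>b\<in>S. Poly_Mapping.lookup v b *\<^sub>k bas b"] unfolding vs_def by blast
    ultimately show ?case using insert assms(3,4) by auto
  qed
  have "v = (\<Sum>b\<in>Poly_Mapping.keys v. Poly_Mapping.lookup v b *\<^sub>k bas b)"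
  proof (rule poly_mapping_eqI)
    fix e
    have "Poly_Mapping.lookup (\<Sum>b\<in>Poly_Mapping.keys v. Poly_Mapping.lookup v b *\<^sub>k bas b) e =
        (\<Sum>b\<in>Poly_Mapping.keys v. if b = e then Poly_Mapping.lookup v b else 0)"
      unfolding lookup_sum by (intro sum.cong) (simp_all add: bas_def lookup_single when_def)
    also have "\<dots> = Poly_Mapping.lookup v e"
      by (simp add: in_keys_iff)
    finally show "Poly_Mapping.lookup v e =
        Poly_Mapping.lookup (\<Sum>b\<in>Poly_Mapping.keys v. Poly_Mapping.lookup v b *\<^sub>k bas b) e" ..
  qed
  moreover have "Poly_Mapping.keys v \<subseteq> B" using assms(1) by (simp add: vs_def)
  ultimately show ?thesis using mem[of "Poly_Mapping.keys v"] by simp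
qed

lemma tensor_simps [simp]:
  "(u + u') \<otimes>\<^sub>k v = u \<otimes>\<^sub>k v + u' \<otimes>\<^sub>k v" "(c *\<^sub>k u) \<otimes>\<^sub>k v = c *\<^sub>k (u \<otimes>\<^sub>k v)"
  "u \<otimes>\<^sub>k (c *\<^sub>k v) = c *\<^sub>k (u \<otimes>\<^sub>k v)" "0 \<otimes>\<^sub>k v = 0" "u \<otimes>\<^sub>k 0 = 0"
  "bas b \<otimes>\<^sub>k bas e = bas (b, e)" "(u - u') \<otimes>\<^sub>k v = u \<otimes>\<^sub>k v - u' \<otimes>\<^sub>k v"
  by (auto simp: tensor_def lin_ext_def[of _ u] scal_sum mult.commute intro!: sum.cong)

lemma tensor_add_right [simp]: "u \<otimes>\<^sub>k (v + v') = u \<otimes>\<^sub>k v + u \<otimes>\<^sub>k v'"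
  by (auto simp: tensor_def lin_ext_def[of _ u] sum.distrib)

lemma tensor_diff_right [simp]: "u \<otimes>\<^sub>k (v - v') = u \<otimes>\<^sub>k v - u \<otimes>\<^sub>k v'"
  by (auto simp: tensor_def lin_ext_def[of _ u] sum_subtractf)


context
  fixes G :: "('g, 'm) monoid_scheme" and \<chi> :: "'g \<Rightarrow> 'k::field" and a :: 'g and \<alpha> :: 'k
  assumes datum: "datum G \<chi> a \<alpha>"
begin

interpretation group G using datum by (simp add: datum_def)

private abbreviation (input) "n \<equiv> mult_order (\<chi> a)"
private abbreviation (input) "H \<equiv> rank_one_hopf G \<chi> a \<alpha>"

private lemma aux:
  "a \<in> carrier G" "a [^]\<^bsub>G\<^esub> n \<in> carrier G" "1 < n" "0 < n" "finite (carrier G)"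
  "g \<in> carrier G \<Longrightarrow> a \<otimes>\<^bsub>G\<^esub> g = g \<otimes>\<^bsub>G\<^esub> a"
  "g \<in> carrier G \<Longrightarrow> h \<in> carrier G \<Longrightarrow> \<chi> (g \<otimes>\<^bsub>G\<^esub> h) = \<chi> g * \<chi> h"
  "g \<in> carrier G \<Longrightarrow> \<chi> g \<noteq> 0"
proof -
  show "a \<in> carrier G" "1 < n" "finite (carrier G)" using datum unfolding datum_def by blast+
  thus "a [^]\<^bsub>G\<^esub> n \<in> carrier G" "0 < n" by simp_all
qed (use datum in \<open>unfold datum_def, blast\<close>)+

private lemma chi_one: "\<chi> \<one>\<^bsub>G\<^esub> = 1"
proof -
  have "\<chi> \<one>\<^bsub>G\<^esub> * \<chi> \<one>\<^bsub>G\<^esub> = \<chi> \<one>\<^bsub>G\<^esub> * 1"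
    using aux(7)[OF one_closed one_closed] by simp
  thus ?thesis using aux(8)[OF one_closed] mult_cancel_left by blast
qed

private lemma an_central: "g \<in> carrier G \<Longrightarrow> (a [^]\<^bsub>G\<^esub> m) \<otimes>\<^bsub>G\<^esub> g = g \<otimes>\<^bsub>G\<^esub> (a [^]\<^bsub>G\<^esub> (m::nat))"
proof (induction m)
  case (Suc m)
  have "a [^]\<^bsub>G\<^esub> Suc m \<otimes>\<^bsub>G\<^esub> g = a [^]\<^bsub>G\<^esub> m \<otimes>\<^bsub>G\<^esub> (g \<otimes>\<^bsub>G\<^esub> a)"
    unfolding nat_pow_Suc aux(6)[OF Suc.prems, symmetric] by (intro m_assoc nat_pow_closed aux Suc.prems)
  also have "\<dots> = g \<otimes>\<^bsub>G\<^esub> a [^]\<^bsub>G\<^esub> Suc m"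
    using Suc aux(1) by (simp add: m_assoc[symmetric])
  finally show ?case .
qed simp

private lemma chi_pow: "\<chi> (a [^]\<^bsub>G\<^esub> (m::nat)) = \<chi> a ^ m"
  by (induction m) (simp_all add: chi_one aux(1,7) mult.commute)

private lemma chi_an: "\<chi> (a [^]\<^bsub>G\<^esub> n) = 1"
proof -
  have "\<exists>m. 0 < m \<and> \<chi> a ^ m = 1"
  proof -
    have "Coset.order G > 0" using order_gt_0_iff_finite aux(5) by simp
    moreover have "\<chi> a ^ Coset.order G = 1"
      unfolding chi_pow[symmetric] pow_order_eq_1[OF aux(1)] by (rule chi_one)
    ultimately show ?thesis by blast
  qed
  from LeastI_ex[OF this] show ?thesis by (simp add: chi_pow mult_order_def)
qed

text \<open>The normal form of \<open>gx\<^sup>m\<close> for arbitrary \<open>m\<close>.\<close>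

private function nf :: "'g \<Rightarrow> nat \<Rightarrow> ('g \<times> nat \<Rightarrow>\<^sub>0 'k)" where
  "nf g m = (if m < n then bas (g, m)
     else \<alpha> *\<^sub>k (nf (g \<otimes>\<^bsub>G\<^esub> a [^]\<^bsub>G\<^esub> n) (m - n) - nf g (m - n)))"
  by auto
private termination by (relation "measure snd") (use aux(1-4,7) in auto)

declare nf.simps [simp del]

private lemma nf_small [simp]: "m < n \<Longrightarrow> nf g m = bas (g, m)"
  by (simp add: nf.simps)

private lemma nf_large: "n \<le> m \<Longrightarrow>
    nf g m = \<alpha> *\<^sub>k (nf (g \<otimes>\<^bsub>G\<^esub> a [^]\<^bsub>G\<^esub> n) (m - n) - nf g (m - n))"
  by (subst nf.simps) simp

private lemma mono_mult_nf:
  assumes "i < n" "j < n"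
  shows "mono_mult G \<chi> a \<alpha> (g, i) (h, j) = \<chi> h ^ i *\<^sub>k nf (g \<otimes>\<^bsub>G\<^esub> h) (i + j)"
  using assms
  by (cases "i + j < n") (simp_all add: mono_mult_def Let_def nf_large)

private lemma nf_cases:
  obtains "\<And>g m. g \<in> carrier G \<Longrightarrow> m \<ge> n \<Longrightarrow> nf g m = 0"
    | "\<And>g. g \<in> carrier G \<Longrightarrow> \<chi> g ^ n = 1"
proof (cases "\<forall>g\<in>carrier G. \<chi> g ^ n = 1")
  case False
  hence "\<alpha> *\<^sub>k (bas (a [^]\<^bsub>G\<^esub> n) - bas \<one>\<^bsub>G\<^esub>) = 0"
    using datum by (auto simp: datum_def)
  hence "Poly_Mapping.lookup (\<alpha> *\<^sub>k (bas (a [^]\<^bsub>G\<^esub> n) - bas \<one>\<^bsub>G\<^esub>)) \<one>\<^bsub>G\<^esub> = 0" by simp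
  hence "\<alpha> = 0 \<or> a [^]\<^bsub>G\<^esub> n = \<one>\<^bsub>G\<^esub>"
    by (auto simp: bas_def lookup_minus lookup_single when_def split: if_splits)
  hence "nf g m = 0" if "g \<in> carrier G" "m \<ge> n" for g m
    using that by (subst nf_large) auto
  thus ?thesis using that by blast
qed (use that in blast)

private lemma nf_shift:
  assumes "g \<in> carrier G" "h \<in> carrier G" "n \<le> m" "n \<le> i"
  shows "\<chi> h ^ (i - n) *\<^sub>k nf g m = \<chi> h ^ i *\<^sub>k nf g m"
proof (cases rule: nf_cases)
  case 2
  have "\<chi> h ^ i = \<chi> h ^ (i - n) * \<chi> h ^ n" using assms by (simp flip: power_add)
  thus ?thesis using 2 assms by simp
qed (use assms in auto)

private lemma pmult_simps [simp]:
  "(u + v) \<star>\<^bsub>H\<^esub> w = u \<star>\<^bsub>H\<^esub> w + v \<star>\<^bsub>H\<^esub> w" "w \<star>\<^bsub>H\<^esub> (u + v) = w \<star>\<^bsub>H\<^esub> u + w \<star>\<^bsub>H\<^esub> v"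
  "(u - v) \<star>\<^bsub>H\<^esub> w = u \<star>\<^bsub>H\<^esub> w - v \<star>\<^bsub>H\<^esub> w" "w \<star>\<^bsub>H\<^esub> (u - v) = w \<star>\<^bsub>H\<^esub> u - w \<star>\<^bsub>H\<^esub> v"
  "(c *\<^sub>k u) \<star>\<^bsub>H\<^esub> w = c *\<^sub>k (u \<star>\<^bsub>H\<^esub> w)" "w \<star>\<^bsub>H\<^esub> (c *\<^sub>k u) = c *\<^sub>k (w \<star>\<^bsub>H\<^esub> u)"
  "0 \<star>\<^bsub>H\<^esub> w = 0" "w \<star>\<^bsub>H\<^esub> 0 = 0"
  by (auto simp: pmult_def rank_one_hopf_def H_prod_def)

private lemma pmult_bas:
  "i < n \<Longrightarrow> j < n \<Longrightarrow> bas (g, i) \<star>\<^bsub>H\<^esub> bas (h, j) = \<chi> h ^ i *\<^sub>k nf (g \<otimes>\<^bsub>G\<^esub> h) (i + j)"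
  by (simp add: pmult_def rank_one_hopf_def H_prod_def mono_mult_nf)

private lemma nf_mult:
  assumes "g \<in> carrier G" "h \<in> carrier G" "j < n"
  shows "nf g i \<star>\<^bsub>H\<^esub> bas (h, j) = \<chi> h ^ i *\<^sub>k nf (g \<otimes>\<^bsub>G\<^esub> h) (i + j)"
  using assms(1)
proof (induction i arbitrary: g rule: less_induct)
  case (less i)
  show ?case
  proof (cases "i < n")
    case True
    thus ?thesis using assms by (simp add: pmult_bas)
  next
    case False
    have eq: "g \<otimes>\<^bsub>G\<^esub> a [^]\<^bsub>G\<^esub> n \<otimes>\<^bsub>G\<^esub> h = g \<otimes>\<^bsub>G\<^esub> h \<otimes>\<^bsub>G\<^esub> a [^]\<^bsub>G\<^esub> n"
      using an_central[of h n] less.prems assms aux(1-4,7) by (simp add: m_assoc)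
    have "nf g i \<star>\<^bsub>H\<^esub> bas (h, j) = \<alpha> *\<^sub>k (nf (g \<otimes>\<^bsub>G\<^esub> a [^]\<^bsub>G\<^esub> n) (i - n) \<star>\<^bsub>H\<^esub> bas (h, j)
        - nf g (i - n) \<star>\<^bsub>H\<^esub> bas (h, j))"
      by (subst nf_large) (use False in simp_all)
    also have "\<dots> = \<alpha> *\<^sub>k (\<chi> h ^ (i - n) *\<^sub>k nf (g \<otimes>\<^bsub>G\<^esub> h \<otimes>\<^bsub>G\<^esub> a [^]\<^bsub>G\<^esub> n) (i - n + j)
        - \<chi> h ^ (i - n) *\<^sub>k nf (g \<otimes>\<^bsub>G\<^esub> h) (i - n + j))"
      using False less.prems aux(1-4,7) by (simp add: less.IH eq)
    also have "\<dots> = \<chi> h ^ (i - n) *\<^sub>k nf (g \<otimes>\<^bsub>G\<^esub> h) (i + j)"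
      by (subst (3) nf_large) (use False in \<open>simp_all add: mult.commute\<close>)
    also have "\<dots> = \<chi> h ^ i *\<^sub>k nf (g \<otimes>\<^bsub>G\<^esub> h) (i + j)"
      using False less.prems assms by (intro nf_shift) auto
    finally show ?thesis .
  qed
qed

private lemma mult_nf:
  assumes "g \<in> carrier G" "h \<in> carrier G" "i < n"
  shows "bas (g, i) \<star>\<^bsub>H\<^esub> nf h j = \<chi> h ^ i *\<^sub>k nf (g \<otimes>\<^bsub>G\<^esub> h) (i + j)"
  using assms(2)
proof (induction j arbitrary: h rule: less_induct)
  case (less j)
  show ?case
  proof (cases "j < n")
    case True
    thus ?thesis using assms by (simp add: pmult_bas)
  next
    case False
    have "bas (g, i) \<star>\<^bsub>H\<^esub> nf h j = \<alpha> *\<^sub>k (bas (g, i) \<star>\<^bsub>H\<^esub> nf (h \<otimes>\<^bsub>G\<^esub> a [^]\<^bsub>G\<^esub> n) (j - n)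
        - bas (g, i) \<star>\<^bsub>H\<^esub> nf h (j - n))"
      by (subst nf_large) (use False in simp_all)
    also have "\<dots> = \<chi> h ^ i *\<^sub>k \<alpha> *\<^sub>k (nf (g \<otimes>\<^bsub>G\<^esub> h \<otimes>\<^bsub>G\<^esub> a [^]\<^bsub>G\<^esub> n) (i + j - n)
        - nf (g \<otimes>\<^bsub>G\<^esub> h) (i + j - n))"
      using False less.prems assms aux(1-4,7) chi_an by (simp add: less.IH m_assoc mult.commute)
    also have "\<dots> = \<chi> h ^ i *\<^sub>k nf (g \<otimes>\<^bsub>G\<^esub> h) (i + j)"
      by (subst (3) nf_large) (use False in simp_all)
    finally show ?thesis .
  qed
qed

lemma H_mult_assoc:
  assumes "u \<in> csp H" "v \<in> csp H" "w \<in> csp H"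
  shows "(u \<star>\<^bsub>H\<^esub> v) \<star>\<^bsub>H\<^esub> w = u \<star>\<^bsub>H\<^esub> (v \<star>\<^bsub>H\<^esub> w)"
proof -
  have bas: "(bas (g, i) \<star>\<^bsub>H\<^esub> bas (h, j)) \<star>\<^bsub>H\<^esub> bas (l, k) = bas (g, i) \<star>\<^bsub>H\<^esub> (bas (h, j) \<star>\<^bsub>H\<^esub> bas (l, k))"
    if "g \<in> carrier G" "h \<in> carrier G" "l \<in> carrier G" "i < n" "j < n" "k < n" for g h l i j k
    using that by (simp add: pmult_bas nf_mult mult_nf m_assoc aux(1-4,7) power_mult_distrib power_add add.assoc mult_ac)
  have B: "cbasis H = carrier G \<times> {..<n}" by (simp add: rank_one_hopf_def)
  have "(bas b \<star>\<^bsub>H\<^esub> bas c) \<star>\<^bsub>H\<^esub> w = bas b \<star>\<^bsub>H\<^esub> (bas c \<star>\<^bsub>H\<^esub> w)" if "b \<in> cbasis H" "c \<in> cbasis H" for b c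
    using assms(3) by (induction rule: vs_induct) (use that B bas in auto)
  note step = this
  have "(bas b \<star>\<^bsub>H\<^esub> v) \<star>\<^bsub>H\<^esub> w = bas b \<star>\<^bsub>H\<^esub> (v \<star>\<^bsub>H\<^esub> w)" if "b \<in> cbasis H" for b
    using assms(2) by (induction rule: vs_induct) (use that step in auto)
  note step = this
  show ?thesis
    using assms(1) by (induction rule: vs_induct) (use step in auto)
qed

lemma H_unity:
  assumes "v \<in> csp H"
  shows "unity H \<star>\<^bsub>H\<^esub> v = v" "v \<star>\<^bsub>H\<^esub> unity H = v"
proof -
  have 1: "unity H = bas (\<one>\<^bsub>G\<^esub>, 0)" by (simp add: rank_one_hopf_def grp_def)
  have bas: "unity H \<star>\<^bsub>H\<^esub> bas e = bas e \<and> bas e \<star>\<^bsub>H\<^esub> unity H = bas e" if e: "e \<in> cbasis H" for e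
  proof -
    obtain g m where "e = (g, m)" "g \<in> carrier G" "m < n"
      using e by (auto simp: rank_one_hopf_def)
    thus ?thesis using aux(3) by (simp add: 1 pmult_bas chi_one)
  qed
  show "unity H \<star>\<^bsub>H\<^esub> v = v"
    using assms by (induction rule: vs_induct) (simp_all add: bas)
  show "v \<star>\<^bsub>H\<^esub> unity H = v"
    using assms by (induction rule: vs_induct) (simp_all add: bas)
qed

private lemma grp_x_pow:
  assumes "g \<in> carrier G"
  shows "((\<lambda>u. u \<star>\<^bsub>H\<^esub> gen_x G) ^^ m) (grp g) = nf g m"
  using aux(1-4) assms
  by (induction m) (auto simp: gen_x_def grp_def nf_mult chi_one)

lemma H_monomial:
  assumes "g \<in> carrier G" "m < n"
  shows "bas (g, m) = ((\<lambda>u. u \<star>\<^bsub>H\<^esub> gen_x G) ^^ m) (grp g)"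
  using assms by (simp add: grp_x_pow)

lemma H_relations:
  "g \<in> carrier G \<Longrightarrow> h \<in> carrier G \<Longrightarrow> grp g \<star>\<^bsub>H\<^esub> grp h = grp (g \<otimes>\<^bsub>G\<^esub> h)"
  "g \<in> carrier G \<Longrightarrow> gen_x G \<star>\<^bsub>H\<^esub> grp g = \<chi> g *\<^sub>k (grp g \<star>\<^bsub>H\<^esub> gen_x G)"
  "((\<lambda>u. u \<star>\<^bsub>H\<^esub> gen_x G) ^^ n) (unity H) = \<alpha> *\<^sub>k (grp (a [^]\<^bsub>G\<^esub> n) - unity H)"
proof -
  have "((\<lambda>u. u \<star>\<^bsub>H\<^esub> gen_x G) ^^ n) (grp \<one>\<^bsub>G\<^esub>) = \<alpha> *\<^sub>k (grp (a [^]\<^bsub>G\<^esub> n) - grp \<one>\<^bsub>G\<^esub>)"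
    unfolding grp_x_pow[OF one_closed] using aux(1-4)
    by (subst nf_large) (simp_all add: grp_def)
  thus "((\<lambda>u. u \<star>\<^bsub>H\<^esub> gen_x G) ^^ n) (unity H) = \<alpha> *\<^sub>k (grp (a [^]\<^bsub>G\<^esub> n) - unity H)"
    by (simp add: rank_one_hopf_def)
qed (use aux(1-4,7) in \<open>auto simp: grp_def gen_x_def pmult_bas chi_one\<close>)

lemma H_universal:
  fixes sc :: "'k \<Rightarrow> 'r \<Rightarrow> 'r::ring_1" and f :: "'g \<Rightarrow> 'r" and y :: 'r
  assumes "vector_space sc"
    and sc: "\<And>c u v. sc c u * v = sc c (u * v)" "\<And>c u v. u * sc c v = sc c (u * v)"
    and f: "f \<one>\<^bsub>G\<^esub> = 1" "\<And>g h. g \<in> carrier G \<Longrightarrow> h \<in> carrier G \<Longrightarrow> f (g \<otimes>\<^bsub>G\<^esub> h) = f g * f h"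
    and y: "\<And>g. g \<in> carrier G \<Longrightarrow> y * f g = sc (\<chi> g) (f g * y)"
      "y ^ n = sc \<alpha> (f (a [^]\<^bsub>G\<^esub> n) - 1)"
  defines "is_hom \<equiv> \<lambda>\<phi>. (\<forall>u\<in>csp H. \<forall>v\<in>csp H. \<phi> (u + v) = \<phi> u + \<phi> v \<and> \<phi> (u \<star>\<^bsub>H\<^esub> v) = \<phi> u * \<phi> v) \<and>
      (\<forall>c. \<forall>u\<in>csp H. \<phi> (c *\<^sub>k u) = sc c (\<phi> u)) \<and> \<phi> (unity H) = 1 \<and>
      (\<forall>g\<in>carrier G. \<phi> (grp g) = f g) \<and> \<phi> (gen_x G) = y"
  shows "\<exists>\<phi>. is_hom \<phi> \<and> (\<forall>\<psi>. is_hom \<psi> \<longrightarrow> (\<forall>v\<in>csp H. \<psi> v = \<phi> v))"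
proof -
  interpret V: vector_space sc by fact
  define b where "b = (\<lambda>(g, m). f g * y ^ m)"
  define \<phi> where "\<phi> = (\<lambda>v. \<Sum>e\<in>Poly_Mapping.keys v. sc (Poly_Mapping.lookup v e) (b e))"
  have sup: "\<phi> v = (\<Sum>e\<in>S. sc (Poly_Mapping.lookup v e) (b e))"
    if "finite S" "Poly_Mapping.keys v \<subseteq> S" for v S
    unfolding \<phi>_def using that by (intro sum.mono_neutral_left) (auto simp: in_keys_iff)
  have add: "\<phi> (u + v) = \<phi> u + \<phi> v" for u v
  proof -
    let ?S = "Poly_Mapping.keys u \<union> Poly_Mapping.keys v"
    have "\<phi> w = (\<Sum>e\<in>?S. sc (Poly_Mapping.lookup w e) (b e))" if "w \<in> {u, v, u + v}" for w
      using that keys_add[of u v] by (intro sup) auto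
    thus ?thesis by (simp add: lookup_add V.scale_left_distrib sum.distrib)
  qed
  have diff: "\<phi> (u - v) = \<phi> u - \<phi> v" for u v
    using add[of "u - v" v] by simp
  have scal: "\<phi> (c *\<^sub>k u) = sc c (\<phi> u)" for c u
    by (subst sup[of "Poly_Mapping.keys u"]) (auto simp: keys_scal \<phi>_def V.scale_sum_right)
  have bas: "\<phi> (bas e) = b e" for e by (simp add: \<phi>_def bas_def)
  have zero: "\<phi> 0 = 0" by (simp add: \<phi>_def)
  have yan: "y ^ m * f g = sc (\<chi> g ^ m) (f g * y ^ m)" if "g \<in> carrier G" for m g
  proof (induction m)
    case (Suc m)
    have "y ^ Suc m * f g = y * (y ^ m * f g)" by (simp add: mult.assoc)
    also have "\<dots> = sc (\<chi> g ^ m) (y * f g * y ^ m)" by (simp only: Suc sc mult.assoc)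
    also have "\<dots> = sc (\<chi> g ^ Suc m) (f g * y ^ Suc m)"
      by (simp add: y that sc mult.assoc mult.commute)
    finally show ?case .
  qed simp
  have nf: "\<phi> (nf g m) = f g * y ^ m" if "g \<in> carrier G" for g m
    using that
  proof (induction m arbitrary: g rule: less_induct)
    case (less m)
    show ?case
    proof (cases "m < n")
      case True
      thus ?thesis by (simp add: bas b_def)
    next
      case False
      have "\<phi> (nf g m) = sc \<alpha> (f g * f (a [^]\<^bsub>G\<^esub> n) * y ^ (m - n) - f g * y ^ (m - n))"
        by (subst nf_large) (use False less.prems aux(1-4,7) in \<open>simp_all add: scal diff less.IH f del: scal_simps(2)\<close>)
      also have "\<dots> = f g * (y ^ n * y ^ (m - n))"
        by (simp add: y sc algebra_simps)
      also have "\<dots> = f g * y ^ m" using False by (simp flip: power_add)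
      finally show ?thesis .
    qed
  qed
  have B: "cbasis H = carrier G \<times> {..<n}" by (simp add: rank_one_hopf_def)
  have bb: "\<phi> (bas e \<star>\<^bsub>H\<^esub> bas e') = \<phi> (bas e) * \<phi> (bas e')" if "e \<in> cbasis H" "e' \<in> cbasis H" for e e'
  proof -
    obtain g i h j where e: "e = (g, i)" "e' = (h, j)" by fastforce
    have "f g * y ^ i * (f h * y ^ j) = f g * (y ^ i * f h) * y ^ j" by (simp add: mult.assoc)
    also have "\<dots> = sc (\<chi> h ^ i) (f g * f h * y ^ (i + j))"
      using that e B by (simp add: yan sc mult.assoc power_add)
    finally show ?thesis using that e B
      by (simp add: pmult_bas scal nf bas b_def f)
  qed
  have "\<phi> (bas e \<star>\<^bsub>H\<^esub> v) = \<phi> (bas e) * \<phi> v" if "e \<in> cbasis H" "v \<in> csp H" for e v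
    using that(2) by (induction rule: vs_induct) (auto simp: zero add scal bb that distrib_left sc)
  note step = this
  have mult: "\<phi> (u \<star>\<^bsub>H\<^esub> v) = \<phi> u * \<phi> v" if "u \<in> csp H" "v \<in> csp H" for u v
    using that by (induction rule: vs_induct) (auto simp: zero add scal distrib_right sc step)
  have "is_hom \<phi>"
    unfolding is_hom_def
    by (auto simp: add mult scal bas grp_def gen_x_def b_def f) (simp add: rank_one_hopf_def grp_def bas b_def f)
  moreover have "\<psi> v = \<phi> v" if \<psi>: "is_hom \<psi>" and v: "v \<in> csp H" for \<psi> v
  proof -
    have mem: "bas (g, m) \<in> csp H" if "g \<in> carrier G" "m < n" for g m
      using that B by (auto simp: vs_def bas_def)
    have *: "\<psi> (bas (g, m)) = f g * y ^ m" if "g \<in> carrier G" "m < n" for g m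
      using that
    proof (induction m)
      case 0
      thus ?case using \<psi> by (simp add: is_hom_def grp_def)
    next
      case (Suc m)
      have "bas (g, Suc m) = bas (g, m) \<star>\<^bsub>H\<^esub> gen_x G"
        using Suc.prems by (simp add: H_monomial)
      moreover have "gen_x G \<in> csp H" using aux(1-4) mem by (simp add: gen_x_def)
      ultimately have "\<psi> (bas (g, Suc m)) = \<psi> (bas (g, m)) * \<psi> (gen_x G)"
        using \<psi> mem[of g m] Suc.prems by (simp add: is_hom_def)
      also have "\<dots> = f g * y ^ m * y" using \<psi> Suc by (simp add: is_hom_def)
      finally show ?case by (simp add: mult.assoc power_commutes)
    qed
    have "0 \<in> csp H" by (simp add: vs_def)
    hence "\<psi> (0 + 0) = \<psi> 0 + \<psi> 0" using \<psi> unfolding is_hom_def by blast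
    hence z: "\<psi> 0 = 0" by simp
    show ?thesis
      using v
    proof (induction rule: vs_induct)
      case (scal c e)
      then obtain g m where "e = (g, m)" "g \<in> carrier G" "m < n" using B by auto
      moreover from this have "\<psi> (c *\<^sub>k bas e) = sc c (\<psi> (bas e))"
        using \<psi> mem by (simp add: is_hom_def)
      ultimately show ?case using * by (simp add: \<open>\<And>c u. \<phi> (c *\<^sub>k u) = sc c (\<phi> u)\<close> bas b_def)
    next
      case (add u v)
      thus ?case using \<psi> \<open>\<And>u v. \<phi> (u + v) = \<phi> u + \<phi> v\<close> by (simp add: is_hom_def)
    qed (simp add: z zero)
  qed
  ultimately show ?thesis by blast
qed

end


text \<open>The element of \<open>G\<close> given by a vector of \<open>H\<close> lying in \<open>G\<close>; needed to apply \<open>\<chi>\<close> to such a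
  vector.\<close>

definition grp_of :: "('g, 'm) monoid_scheme \<Rightarrow> ('g \<times> nat \<Rightarrow>\<^sub>0 'k::field) \<Rightarrow> 'g" where
  "grp_of G = the_inv_into (carrier G) grp"

end

theory Submission
  imports Defs
begin

text \<open>
  The operator \<open>s\<close> is determined by the values of \<open>\<cdot>\<close> and \<open>\<Colon>\<close> on the elements \<open>g\<close> and \<open>gx\<close>,
  and these values are forced by looking at the axioms on elements of degree at most one.

  The coalgebra morphism axiom of a q-magma coalgebra has three components: \<open>\<cdot>\<close> and \<open>\<Colon>\<close> are
  each comultiplicative up to a flip, and
  \<open>y\<^sub>1 \<Colon> x\<^sub>2 \<otimes> x\<^sub>1 \<cdot> y\<^sub>2 = y\<^sub>2 \<Colon> x\<^sub>1 \<otimes> x\<^sub>2 \<cdot> y\<^sub>1\<close> (\<open>q_magma_components\<close>).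
  By the first two, \<open>h \<cdot> g\<close> is group-like, hence in \<open>G\<close>, and \<open>x \<cdot> g\<close> is skew primitive. Since
  \<open>u \<mapsto> u \<cdot> g\<close> is injective, \<open>x \<cdot> g\<close> is not a combination of group elements, so
  \<open>a \<cdot> g = a\<close> and \<open>x \<cdot> g = c\<^sub>g x + m\<^sub>g (1 - a)\<close> with \<open>c\<^sub>g \<noteq> 0\<close> (\<open>x_act_grp\<close>);
  likewise \<open>x \<Colon> g = c'\<^sub>g x + m'\<^sub>g (1 - a)\<close>. The third component at \<open>h \<otimes> x\<close>, \<open>x \<otimes> h\<close> and
  \<open>x \<otimes> x\<close> then shows that \<open>a\<close> acts trivially on \<open>G\<close> and that \<open>h \<cdot> x = h \<Colon> x = 0\<close>, and
  expresses \<open>x \<Colon> x\<close> through \<open>x \<cdot> x = \<lambda>(1 - a)\<close> and shows \<open>m'\<^sub>a = 0\<close> (\<open>compat_x_x\<close>).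

  Acting on \<open>x\<close> with both sides of \<open>xg = \<chi>(g)gx\<close> gives \<open>c\<^sub>g = \<chi>(g)\<close>, because \<open>x \<cdot> x\<close> is a
  nonzero multiple of the fixed vector \<open>1 - a\<close>; the same argument for \<open>\<Colon>\<close> gives
  \<open>c'\<^sub>g = \<chi>(g)\<close>, \<open>m\<^sub>a = 0\<close> and \<open>x \<Colon> x = -\<lambda>(1 - a)\<close>. Finally \<open>m\<close> and \<open>m'\<close> are cocycles
  on \<open>G\<close> vanishing at the central element \<open>a\<close>, where \<open>\<chi>(a) \<noteq> 1\<close>, so they vanish. The
  formulas for \<open>hk \<cdot> l\<close> and \<open>hk \<Colon> l\<close> extend these values to all \<open>hx\<close> and \<open>gx\<close>; on the span
  of the corresponding tensors the map \<open>G_bar\<close> is triangular and can be inverted explicitly,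
  which yields the two exponentials and \<open>s\<close>.
\<close>

section \<open>Linear maps given on a basis\<close>

lemma vs_zero [simp]: "0 \<in> vs B"
  by (simp add: vs_def)

lemma vs_add [simp]: "u \<in> vs B \<Longrightarrow> v \<in> vs B \<Longrightarrow> u + v \<in> vs B"
  using keys_add[of u v] unfolding vs_def by blast

lemma vs_scal [simp]: "v \<in> vs B \<Longrightarrow> c *\<^sub>k v \<in> vs B"
  using keys_scal[of c v] unfolding vs_def by blast

lemma vs_diff [simp]: "u \<in> vs B \<Longrightarrow> v \<in> vs B \<Longrightarrow> u - v \<in> vs B"
  using keys_diff[of u v] unfolding vs_def by blast

lemma vs_bas [simp]: "bas b \<in> vs B \<longleftrightarrow> b \<in> B"
  by (simp add: vs_def bas_def)

lemma vs_UNIV [simp]: "v \<in> vs UNIV"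
  by (simp add: vs_def)

lemma lookup_bas: "Poly_Mapping.lookup (bas b) e = (if b = e then 1 else 0)"
  by (simp add: bas_def lookup_single when_def)

lemma lookup_outside: "v \<in> vs B \<Longrightarrow> b \<notin> B \<Longrightarrow> Poly_Mapping.lookup v b = 0"
  by (auto simp: vs_def in_keys_iff)

lemma vs_lin_ext:
  assumes "v \<in> vs B" "\<And>b. b \<in> B \<Longrightarrow> f b \<in> vs C"
  shows "lin_ext f v \<in> vs C"
  using assms(1) by (induction rule: vs_induct) (use assms(2) in auto)

lemma vs_tensor [simp]:
  assumes "u \<in> vs B" "v \<in> vs C"
  shows "u \<otimes>\<^sub>k v \<in> vs (B \<times> C)"
  unfolding tensor_def using assms by (intro vs_lin_ext[of u B] vs_lin_ext[of v C]) auto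

lemma lin_ext_cong:
  assumes "v \<in> vs B" "\<And>b. b \<in> B \<Longrightarrow> f b = g b"
  shows "lin_ext f v = lin_ext g v"
  using assms(1) by (induction rule: vs_induct) (use assms(2) in auto)

lemma lin_ext_lin_ext: "lin_ext f (lin_ext g v) = lin_ext (\<lambda>b. lin_ext f (g b)) v"
  using vs_UNIV[of v] by (induction rule: vs_induct) auto

lemma lin_ext_id [simp]: "lin_ext bas v = v"
  using vs_UNIV[of v] by (induction rule: vs_induct) auto

lemma lin_ext_scal_fun: "lin_ext (\<lambda>b. c *\<^sub>k f b) v = c *\<^sub>k lin_ext f v"
  using vs_UNIV[of v] by (induction rule: vs_induct) (auto simp: mult.commute)

lemma lin_ext_tensor:
  "lin_ext (\<lambda>(b, c). f b \<otimes>\<^sub>k g c) (u \<otimes>\<^sub>k v) = lin_ext f u \<otimes>\<^sub>k lin_ext g v"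
proof -
  have "lin_ext (\<lambda>(b, c). f b \<otimes>\<^sub>k g c) (bas b \<otimes>\<^sub>k v) = f b \<otimes>\<^sub>k lin_ext g v" for b
    using vs_UNIV[of v] by (induction rule: vs_induct) auto
  note step = this
  show ?thesis
    using vs_UNIV[of u] by (induction rule: vs_induct) (auto simp: step)
qed

lemma flip_tensor: "lin_ext (\<lambda>x. bas (snd x, fst x)) (u \<otimes>\<^sub>k v) = v \<otimes>\<^sub>k u"
proof -
  have "lin_ext (\<lambda>x. bas (snd x, fst x)) (bas b \<otimes>\<^sub>k v) = v \<otimes>\<^sub>k bas b" for b
    using vs_UNIV[of v] by (induction rule: vs_induct) auto
  note step = this
  show ?thesis
    using vs_UNIV[of u] by (induction rule: vs_induct) (auto simp: step)
qed

lemma lookup_tensor: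
  "Poly_Mapping.lookup (u \<otimes>\<^sub>k v) (b, c) = Poly_Mapping.lookup u b * Poly_Mapping.lookup v c"
proof -
  have "Poly_Mapping.lookup (bas e \<otimes>\<^sub>k v) (b, c) = Poly_Mapping.lookup (bas e) b * Poly_Mapping.lookup v c" for e
    using vs_UNIV[of v] by (induction rule: vs_induct) (auto simp: lookup_add lookup_bas algebra_simps)
  note step = this
  show ?thesis
    using vs_UNIV[of u] by (induction rule: vs_induct) (auto simp: step lookup_add algebra_simps)
qed

lemma tlift_simps [simp]:
  "tlift 0 F = 0" "tlift (s + t) F = tlift s F + tlift t F"
  "tlift (c *\<^sub>k t) F = c *\<^sub>k tlift t F" "tlift (bas (b, e)) F = F (bas b) (bas e)"
  by (simp_all add: tlift_def)

lemma linear_onD: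
  assumes "linear_on B C f"
  shows "v \<in> vs B \<Longrightarrow> f v \<in> vs C" "u \<in> vs B \<Longrightarrow> v \<in> vs B \<Longrightarrow> f (u + v) = f u + f v"
    "v \<in> vs B \<Longrightarrow> f (c *\<^sub>k v) = c *\<^sub>k f v" "f 0 = 0"
proof -
  show "v \<in> vs B \<Longrightarrow> f v \<in> vs C" "u \<in> vs B \<Longrightarrow> v \<in> vs B \<Longrightarrow> f (u + v) = f u + f v"
    and *: "v \<in> vs B \<Longrightarrow> f (c *\<^sub>k v) = c *\<^sub>k f v" for u v c
    using assms by (auto simp: linear_on_def)
  show "f 0 = 0" using *[of 0 0] by simp
qed

section \<open>The components of the structure map of a q-magma coalgebra\<close>

definition counit_fst :: "('b, 'k::field, 'z) coalg_scheme \<Rightarrow> 'b \<times> 'b \<Rightarrow> ('b \<Rightarrow>\<^sub>0 'k)" where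
  "counit_fst X = (\<lambda>(b, c). counit X (bas b) *\<^sub>k bas c)"

definition counit_snd :: "('b, 'k::field, 'z) coalg_scheme \<Rightarrow> 'b \<times> 'b \<Rightarrow> ('b \<Rightarrow>\<^sub>0 'k)" where
  "counit_snd X = (\<lambda>(b, c). counit X (bas c) *\<^sub>k bas b)"

lemma comult_cop_tensor_bas:
  "lin_ext f (comult (tensor_coalg (cop X) X) (bas (b, c))) =
    lin_ext (\<lambda>(b1, b2). lin_ext (\<lambda>(c1, c2). f ((b2, c1), (b1, c2))) (comult X (bas c)))
      (comult X (bas b))"
  by (simp add: tensor_coalg_def cop_def tlift_def lin_ext_lin_ext case_prod_beta')

lemma comult_tensor_cop_bas:
  "lin_ext f (comult (tensor_coalg X (cop X)) (bas (b, c))) =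
    lin_ext (\<lambda>(b1, b2). lin_ext (\<lambda>(c1, c2). f ((b1, c2), (b2, c1))) (comult X (bas c)))
      (comult X (bas b))"
  by (simp add: tensor_coalg_def cop_def tlift_def lin_ext_lin_ext case_prod_beta')

context
  fixes X :: "('b, 'k::field, 'z) coalg_scheme"
  assumes X: "coalgebra X"
begin

private abbreviation (input) "B \<equiv> cbasis X"

lemma counit_scal_eq_lin_ext:
  assumes "v \<in> csp X"
  shows "lin_ext (\<lambda>b. counit X (bas b) *\<^sub>k z) v = counit X v *\<^sub>k z"
proof -
  have f: "linear_form_on B (counit X)" using X by (simp add: coalgebra_def)
  hence "counit X (0 *\<^sub>k 0) = 0 * counit X 0"
    using vs_zero[of B] unfolding linear_form_on_def by blast
  hence 0: "counit X 0 = 0" by simp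
  show ?thesis using assms
    by (induction rule: vs_induct)
       (use f in \<open>auto simp: 0 linear_form_on_def scal_add_left\<close>)
qed

lemma comult_in_vs: "v \<in> csp X \<Longrightarrow> comult X v \<in> vs (B \<times> B)"
  using X by (simp add: coalgebra_def linear_on_def)

text \<open>
  The counit axioms with a map applied to the surviving factor, so that in a nested Sweedler sum
  they can be used under an operation such as \<open>e \<mapsto> p(b \<otimes> e)\<close>.
\<close>

lemma lin_ext_counit_left:
  assumes "b \<in> cbasis X"
  shows "lin_ext (\<lambda>(b1, b2). counit X (bas b1) *\<^sub>k f b2) (comult X (bas b)) = f b"
proof -
  have "tlift (comult X (bas b)) (\<lambda>v1 v2. counit X v1 *\<^sub>k v2) = bas b"
    using X assms by (simp add: coalgebra_def)
  hence "lin_ext f (tlift (comult X (bas b)) (\<lambda>v1 v2. counit X v1 *\<^sub>k v2)) = f b" by simp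
  thus ?thesis by (simp add: tlift_def lin_ext_lin_ext case_prod_beta')
qed

lemma lin_ext_counit_right:
  assumes "b \<in> cbasis X"
  shows "lin_ext (\<lambda>(b1, b2). counit X (bas b2) *\<^sub>k f b1) (comult X (bas b)) = f b"
proof -
  have "tlift (comult X (bas b)) (\<lambda>v1 v2. counit X v2 *\<^sub>k v1) = bas b"
    using X assms by (simp add: coalgebra_def)
  hence "lin_ext f (tlift (comult X (bas b)) (\<lambda>v1 v2. counit X v2 *\<^sub>k v1)) = f b" by simp
  thus ?thesis by (simp add: tlift_def lin_ext_lin_ext case_prod_beta')
qed

lemma lin_ext_counit_fst: "u \<in> csp X \<Longrightarrow> lin_ext (counit_fst X) (u \<otimes>\<^sub>k v) = counit X u *\<^sub>k v"
  and lin_ext_counit_snd: "v \<in> csp X \<Longrightarrow> lin_ext (counit_snd X) (u \<otimes>\<^sub>k v) = counit X v *\<^sub>k u"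
proof -
  assume u: "u \<in> csp X"
  have "lin_ext (counit_fst X) (bas b \<otimes>\<^sub>k v) = counit X (bas b) *\<^sub>k v" for b
    using vs_UNIV[of v] by (induction rule: vs_induct) (auto simp: counit_fst_def mult.commute)
  note step = this
  have "lin_ext (counit_fst X) (u \<otimes>\<^sub>k v) = lin_ext (\<lambda>b. counit X (bas b) *\<^sub>k v) u"
    using vs_UNIV[of u] by (induction u rule: vs_induct) (auto simp: step)
  thus "lin_ext (counit_fst X) (u \<otimes>\<^sub>k v) = counit X u *\<^sub>k v"
    using counit_scal_eq_lin_ext[OF u] by simp
next
  assume v: "v \<in> csp X"
  have "lin_ext (counit_snd X) (u \<otimes>\<^sub>k bas c) = counit X (bas c) *\<^sub>k u" for c
    using vs_UNIV[of u] by (induction rule: vs_induct) (auto simp: counit_snd_def mult.commute)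
  note step = this
  have "lin_ext (counit_snd X) (u \<otimes>\<^sub>k v) = lin_ext (\<lambda>c. counit X (bas c) *\<^sub>k u) v"
    using vs_UNIV[of v] by (induction v rule: vs_induct) (auto simp: step)
  thus "lin_ext (counit_snd X) (u \<otimes>\<^sub>k v) = counit X v *\<^sub>k u"
    using counit_scal_eq_lin_ext[OF v] by simp
qed

text \<open>
  On \<open>X\<^sup>c\<^sup>o\<^sup>p \<otimes> X\<close> the coproduct of \<open>u \<otimes> v\<close> is \<open>u\<^sub>2 \<otimes> v\<^sub>1 \<otimes> u\<^sub>1 \<otimes> v\<^sub>2\<close>. Killing two of the
  four factors with the counit, one from each half, leaves \<open>\<Delta>(v)\<close>, \<open>\<Delta>(u)\<close> with its
  factors exchanged, or \<open>u \<otimes> v\<close> itself.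
\<close>

lemma comult_cop_tensor_components:
  assumes "w \<in> vs (B \<times> B)"
  shows "lin_ext (\<lambda>(s, t). counit_fst X s \<otimes>\<^sub>k counit_fst X t) (comult (tensor_coalg (cop X) X) w) =
      lin_ext (\<lambda>(b, c). counit X (bas b) *\<^sub>k comult X (bas c)) w" (is "?l1 w = ?r1 w")
    and "lin_ext (\<lambda>(s, t). counit_snd X t \<otimes>\<^sub>k counit_snd X s) (comult (tensor_coalg (cop X) X) w) =
      lin_ext (\<lambda>(b, c). counit X (bas c) *\<^sub>k comult X (bas b)) w" (is "?l2 w = ?r2 w")
    and "lin_ext (\<lambda>(s, t). counit_snd X s \<otimes>\<^sub>k counit_fst X t) (comult (tensor_coalg (cop X) X) w) = w"
      (is "?l3 w = w")
proof -
  let ?C = "tensor_coalg (cop X) X"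
  have zero: "comult ?C 0 = 0" and add: "comult ?C (u + v) = comult ?C u + comult ?C v"
    and scal: "comult ?C (c *\<^sub>k v) = c *\<^sub>k comult ?C v" for u v c
    by (simp_all add: tensor_coalg_def)
  have l: "lin_ext (\<lambda>x. counit X (bas (fst x)) *\<^sub>k f (snd x)) (comult X (bas b)) = f b"
    if "b \<in> B" for f b
    using lin_ext_counit_left[OF that, of f]
    by (simp add: case_prod_beta')
  have bas: "?l1 (bas (b, c)) = ?r1 (bas (b, c))" "?l2 (bas (b, c)) = ?r2 (bas (b, c))"
    "?l3 (bas (b, c)) = bas (b, c)" if bc: "b \<in> B" "c \<in> B" for b c
  proof -
    have "?l1 (bas (b, c)) = lin_ext (\<lambda>x. counit X (bas (fst x)) *\<^sub>k (counit X (bas (snd x)) *\<^sub>k comult X (bas c)))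
        (comult X (bas b))"
      unfolding comult_cop_tensor_bas
      by (simp add: counit_fst_def case_prod_beta' lin_ext_scal_fun mult.commute)
    thus "?l1 (bas (b, c)) = ?r1 (bas (b, c))"
      by (simp only: l[OF bc(1), of "\<lambda>e. counit X (bas e) *\<^sub>k comult X (bas c)"]) simp
    have "?l2 (bas (b, c)) = lin_ext (\<lambda>x. counit X (bas c) *\<^sub>k bas x) (comult X (bas b))"
    proof -
      have "lin_ext (\<lambda>(c1, c2). counit_snd X (b1, c2) \<otimes>\<^sub>k counit_snd X (b2, c1)) (comult X (bas c))
          = counit X (bas c) *\<^sub>k bas (b1, b2)" for b1 b2
        using l[OF bc(2), of "\<lambda>e. counit X (bas e) *\<^sub>k bas (b1, b2)"]
        by (simp add: counit_snd_def case_prod_beta' mult.commute)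
      thus ?thesis unfolding comult_cop_tensor_bas by (simp add: case_prod_beta')
    qed
    thus "?l2 (bas (b, c)) = ?r2 (bas (b, c))"
      by (simp add: lin_ext_scal_fun)
    have "lin_ext (\<lambda>(c1, c2). counit_snd X (b2, c1) \<otimes>\<^sub>k counit_fst X (b1, c2)) (comult X (bas c))
        = counit X (bas b1) *\<^sub>k bas (b2, c)" for b1 b2
      using l[OF bc(2), of "\<lambda>e. counit X (bas b1) *\<^sub>k bas (b2, e)"]
      by (simp add: counit_snd_def counit_fst_def case_prod_beta' mult.commute)
    thus "?l3 (bas (b, c)) = bas (b, c)"
      using l[OF bc(1), of "\<lambda>e. bas (e, c)"]
      unfolding comult_cop_tensor_bas by (simp add: case_prod_beta')
  qed
  show "?l1 w = ?r1 w" using assms by (induction rule: vs_induct) (use bas(1) in \<open>auto simp: zero add scal\<close>)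
  show "?l2 w = ?r2 w" using assms by (induction rule: vs_induct) (use bas(2) in \<open>auto simp: zero add scal\<close>)
  show "?l3 w = w" using assms by (induction rule: vs_induct) (use bas(3) in \<open>auto simp: zero add scal\<close>)
qed

end

text \<open>
  Let \<open>T(x \<otimes> y) = y\<^sub>1 \<Colon> x\<^sub>2 \<otimes> x\<^sub>1 \<cdot> y\<^sub>2\<close> be the structure map. Its components are
  \<open>(\<epsilon> \<otimes> id)T(x \<otimes> y) = x \<cdot> y\<close> and \<open>(id \<otimes> \<epsilon>)T(x \<otimes> y) = y \<Colon> x\<close>, so applying the three
  functionals of the previous lemma to \<open>\<Delta>(T(x \<otimes> y)) = (T \<otimes> T)\<Delta>(x \<otimes> y)\<close> gives the three
  identities.
\<close>

lemma q_magma_components: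
  fixes X :: "('b, 'k::field, 'z) coalg_scheme"
  assumes "q_magma_coalgebra p d X" and b: "b \<in> cbasis X" and c: "c \<in> cbasis X"
  shows q_magma_comult_dot: "comult X (p (bas b \<otimes>\<^sub>k bas c)) =
      tlift (comult X (bas b)) (\<lambda>b1 b2. tlift (comult X (bas c)) (\<lambda>c1 c2.
        p (b1 \<otimes>\<^sub>k c2) \<otimes>\<^sub>k p (b2 \<otimes>\<^sub>k c1)))"
    and q_magma_comult_col: "comult X (d (bas c \<otimes>\<^sub>k bas b)) =
      tlift (comult X (bas b)) (\<lambda>b1 b2. tlift (comult X (bas c)) (\<lambda>c1 c2.
        d (c1 \<otimes>\<^sub>k b2) \<otimes>\<^sub>k d (c2 \<otimes>\<^sub>k b1)))"
    and q_magma_compat: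
      "tlift (comult X (bas b)) (\<lambda>b1 b2. tlift (comult X (bas c)) (\<lambda>c1 c2.
        d (c1 \<otimes>\<^sub>k b2) \<otimes>\<^sub>k p (b1 \<otimes>\<^sub>k c2))) =
       tlift (comult X (bas b)) (\<lambda>b1 b2. tlift (comult X (bas c)) (\<lambda>c1 c2.
        d (c2 \<otimes>\<^sub>k b1) \<otimes>\<^sub>k p (b2 \<otimes>\<^sub>k c1)))"
proof -
  let ?B = "cbasis X" and ?C = "tensor_coalg X (cop X)" and ?D = "tensor_coalg (cop X) X"
  define T where "T = (\<lambda>t. tlift t (\<lambda>u v. tlift (comult X u) (\<lambda>u1 u2. tlift (comult X v) (\<lambda>v1 v2.
    d (v1 \<otimes>\<^sub>k u2) \<otimes>\<^sub>k p (u1 \<otimes>\<^sub>k v2)))))"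
  have X: "coalgebra X" and p: "linear_on (?B \<times> ?B) ?B p" and d: "linear_on (?B \<times> ?B) ?B d"
    and cp: "\<And>u v. u \<in> csp X \<Longrightarrow> v \<in> csp X \<Longrightarrow> counit X (p (u \<otimes>\<^sub>k v)) = counit X u * counit X v"
    and cd: "\<And>u v. u \<in> csp X \<Longrightarrow> v \<in> csp X \<Longrightarrow> counit X (d (u \<otimes>\<^sub>k v)) = counit X u * counit X v"
    and hom: "coalg_hom ?C ?D T"
    using assms(1) unfolding q_magma_coalgebra_def T_def by blast+
  have p_in: "p (bas (e, e')) \<in> csp X" and d_in: "d (bas (e, e')) \<in> csp X"
    if "e \<in> ?B" "e' \<in> ?B" for e e'
    using that by (auto intro!: linear_onD(1)[OF p] linear_onD(1)[OF d])
  have \<Delta>: "comult X (bas e) \<in> vs (?B \<times> ?B)" if "e \<in> ?B" for e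
    using comult_in_vs[OF X] that by simp
  have T_bas: "lin_ext f (T (bas (e, e'))) =
      lin_ext (\<lambda>(e1, e2). lin_ext (\<lambda>(e1', e2'). lin_ext f (d (bas (e1', e2)) \<otimes>\<^sub>k p (bas (e1, e2'))))
        (comult X (bas e'))) (comult X (bas e))" for e e' f
    by (simp add: T_def) (simp add: tlift_def lin_ext_lin_ext case_prod_beta')
  have T_fst: "lin_ext (counit_fst X) (T (bas (e, e'))) = p (bas (e, e'))"
    if "e \<in> ?B" "e' \<in> ?B" for e e'
  proof -
    have "lin_ext (counit_fst X) (T (bas (e, e'))) =
      lin_ext (\<lambda>(e1, e2). lin_ext (\<lambda>(e1', e2').
        counit X (bas e1') *\<^sub>k (counit X (bas e2) *\<^sub>k p (bas (e1, e2'))))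
        (comult X (bas e'))) (comult X (bas e))"
      unfolding T_bas
    proof (intro lin_ext_cong[OF \<Delta>[OF that(1)]], clarify)
      fix e1 e2 assume e: "e1 \<in> ?B" "e2 \<in> ?B"
      show "lin_ext (\<lambda>(e1', e2'). lin_ext (counit_fst X) (d (bas (e1', e2)) \<otimes>\<^sub>k p (bas (e1, e2'))))
            (comult X (bas e')) =
          lin_ext (\<lambda>(e1', e2'). counit X (bas e1') *\<^sub>k (counit X (bas e2) *\<^sub>k p (bas (e1, e2'))))
            (comult X (bas e'))"
        by (intro lin_ext_cong[OF \<Delta>[OF that(2)]])
           (use e d_in cd[of "bas _" "bas _"] in \<open>auto simp: lin_ext_counit_fst[OF X]\<close>)
    qed
    also have "\<dots> = lin_ext (\<lambda>(e1, e2). counit X (bas e2) *\<^sub>k p (bas (e1, e'))) (comult X (bas e))"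
      by (subst lin_ext_counit_left[OF X that(2), of "\<lambda>y. counit X (bas (_ :: 'b)) *\<^sub>k p (bas (_, y))"]) simp
    also have "\<dots> = p (bas (e, e'))" by (rule lin_ext_counit_right[OF X that(1)])
    finally show ?thesis .
  qed
  have T_snd: "lin_ext (counit_snd X) (T (bas (e, e'))) = d (bas (e', e))"
    if "e \<in> ?B" "e' \<in> ?B" for e e'
  proof -
    have "lin_ext (counit_snd X) (T (bas (e, e'))) =
      lin_ext (\<lambda>(e1, e2). lin_ext (\<lambda>(e1', e2').
        counit X (bas e2') *\<^sub>k (counit X (bas e1) *\<^sub>k d (bas (e1', e2))))
        (comult X (bas e'))) (comult X (bas e))"
      unfolding T_bas
    proof (intro lin_ext_cong[OF \<Delta>[OF that(1)]], clarify)
      fix e1 e2 assume e: "e1 \<in> ?B" "e2 \<in> ?B"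
      show "lin_ext (\<lambda>(e1', e2'). lin_ext (counit_snd X) (d (bas (e1', e2)) \<otimes>\<^sub>k p (bas (e1, e2'))))
            (comult X (bas e')) =
          lin_ext (\<lambda>(e1', e2'). counit X (bas e2') *\<^sub>k (counit X (bas e1) *\<^sub>k d (bas (e1', e2))))
            (comult X (bas e'))"
        by (intro lin_ext_cong[OF \<Delta>[OF that(2)]])
           (use e p_in cp[of "bas _" "bas _"] in \<open>auto simp: lin_ext_counit_snd[OF X] mult.commute\<close>)
    qed
    also have "\<dots> = lin_ext (\<lambda>(e1, e2). counit X (bas e1) *\<^sub>k d (bas (e', e2))) (comult X (bas e))"
      by (subst lin_ext_counit_right[OF X that(2), of "\<lambda>y. counit X (bas (_ :: 'b)) *\<^sub>k d (bas (y, _))"]) simp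
    also have "\<dots> = d (bas (e', e))" by (rule lin_ext_counit_left[OF X that(1)])
    finally show ?thesis .
  qed
  have bc: "bas (b, c) \<in> csp ?C" using b c by (simp add: tensor_coalg_def cop_def)
  have Tbc: "T (bas (b, c)) \<in> vs (?B \<times> ?B)"
    using linear_onD(1)[of "cbasis ?C" "cbasis ?D" T] hom bc
    by (simp add: coalg_hom_def tensor_coalg_def cop_def)
  have \<Delta>T: "comult ?D (T (bas (b, c))) = tlift (comult ?C (bas (b, c))) (\<lambda>s t. T s \<otimes>\<^sub>k T t)"
    using hom bc unfolding coalg_hom_def by blast
  \<comment> \<open>On the other side of the morphism identity, the functionals turn each \<open>T\<close> into one of the
    two operations.\<close>
  have key: "lin_ext (\<lambda>(s, t). f s \<otimes>\<^sub>k g t) (comult ?D (T (bas (b, c)))) =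
      lin_ext (\<lambda>(b1, b2). lin_ext (\<lambda>(c1, c2). f' (b1, c2) \<otimes>\<^sub>k g' (b2, c1)) (comult X (bas c)))
        (comult X (bas b))"
    if f: "\<And>e e'. e \<in> ?B \<Longrightarrow> e' \<in> ?B \<Longrightarrow> lin_ext f (T (bas (e, e'))) = f' (e, e')"
      and g: "\<And>e e'. e \<in> ?B \<Longrightarrow> e' \<in> ?B \<Longrightarrow> lin_ext g (T (bas (e, e'))) = g' (e, e')"
    for f g :: "'b \<times> 'b \<Rightarrow> ('b \<Rightarrow>\<^sub>0 'k)" and f' g'
  proof -
    have "lin_ext (\<lambda>(s, t). f s \<otimes>\<^sub>k g t) (comult ?D (T (bas (b, c)))) =
      lin_ext (\<lambda>(s, t). lin_ext f (T (bas s)) \<otimes>\<^sub>k lin_ext g (T (bas t))) (comult ?C (bas (b, c)))"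
      unfolding \<Delta>T tlift_def lin_ext_lin_ext lin_ext_tensor[symmetric] by (simp add: case_prod_beta')
    also have "\<dots> = lin_ext (\<lambda>(b1, b2). lin_ext (\<lambda>(c1, c2). f' (b1, c2) \<otimes>\<^sub>k g' (b2, c1))
        (comult X (bas c))) (comult X (bas b))"
      unfolding comult_tensor_cop_bas
      by (intro lin_ext_cong[OF \<Delta>[OF b]]) (auto intro!: lin_ext_cong[OF \<Delta>[OF c]] simp: f g)
    finally show ?thesis .
  qed
  note comp = comult_cop_tensor_components[OF X Tbc]
  have \<Delta>_fst: "lin_ext (\<lambda>(b, c). counit X (bas b) *\<^sub>k comult X (bas c)) w =
      comult X (lin_ext (counit_fst X) w)"
    and \<Delta>_snd: "lin_ext (\<lambda>(b, c). counit X (bas c) *\<^sub>k comult X (bas b)) w =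
      comult X (lin_ext (counit_snd X) w)" if "w \<in> vs (?B \<times> ?B)" for w
  proof -
    have lin: "linear_on ?B (?B \<times> ?B) (comult X)" using X by (simp add: coalgebra_def)
    have pair: "counit_fst X (b, c) = counit X (bas b) *\<^sub>k bas c"
      "counit_snd X (b, c) = counit X (bas c) *\<^sub>k bas b" for b c
      by (simp_all add: counit_fst_def counit_snd_def)
    have mem: "lin_ext (counit_fst X) v \<in> csp X" "lin_ext (counit_snd X) v \<in> csp X"
      if "v \<in> vs (?B \<times> ?B)" for v
      using that by (auto intro!: vs_lin_ext[OF that] simp: counit_fst_def counit_snd_def)
    show "lin_ext (\<lambda>(b, c). counit X (bas b) *\<^sub>k comult X (bas c)) w =
        comult X (lin_ext (counit_fst X) w)"
      "lin_ext (\<lambda>(b, c). counit X (bas c) *\<^sub>k comult X (bas b)) w =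
        comult X (lin_ext (counit_snd X) w)"
      using that by (induction rule: vs_induct)
        (auto simp: linear_onD[OF lin] mem pair)
  qed
  show "comult X (p (bas b \<otimes>\<^sub>k bas c)) =
      tlift (comult X (bas b)) (\<lambda>b1 b2. tlift (comult X (bas c)) (\<lambda>c1 c2.
        p (b1 \<otimes>\<^sub>k c2) \<otimes>\<^sub>k p (b2 \<otimes>\<^sub>k c1)))"
    using key[OF T_fst T_fst] unfolding comp \<Delta>_fst[OF Tbc] T_fst[OF b c] by (simp add: tlift_def)
  show "tlift (comult X (bas b)) (\<lambda>b1 b2. tlift (comult X (bas c)) (\<lambda>c1 c2.
        d (c1 \<otimes>\<^sub>k b2) \<otimes>\<^sub>k p (b1 \<otimes>\<^sub>k c2))) =
       tlift (comult X (bas b)) (\<lambda>b1 b2. tlift (comult X (bas c)) (\<lambda>c1 c2.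
        d (c2 \<otimes>\<^sub>k b1) \<otimes>\<^sub>k p (b2 \<otimes>\<^sub>k c1)))"
    using key[of "counit_snd X" "\<lambda>(e, e'). d (bas (e', e))" "counit_fst X" "\<lambda>(e, e'). p (bas (e, e'))"]
    unfolding comp by (simp add: T_fst T_snd) (simp add: T_def tlift_def)
  have "comult X (d (bas (c, b))) = lin_ext (\<lambda>(e, e'). bas (e', e))
      (lin_ext (\<lambda>(s, t). counit_snd X s \<otimes>\<^sub>k counit_snd X t) (comult ?D (T (bas (b, c)))))"
    using comp(2) unfolding \<Delta>_snd[OF Tbc] T_snd[OF b c]
    by (simp add: lin_ext_lin_ext flip_tensor case_prod_beta')
  also have "\<dots> = lin_ext (\<lambda>(e, e'). bas (e', e))
      (lin_ext (\<lambda>(b1, b2). lin_ext (\<lambda>(c1, c2). d (bas (c2, b1)) \<otimes>\<^sub>k d (bas (c1, b2)))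
        (comult X (bas c))) (comult X (bas b)))"
    using key[of "counit_snd X" "\<lambda>(e, e'). d (bas (e', e))" "counit_snd X" "\<lambda>(e, e'). d (bas (e', e))"]
    by (simp add: T_snd)
  finally show "comult X (d (bas c \<otimes>\<^sub>k bas b)) =
      tlift (comult X (bas b)) (\<lambda>b1 b2. tlift (comult X (bas c)) (\<lambda>c1 c2.
        d (c1 \<otimes>\<^sub>k b2) \<otimes>\<^sub>k d (c2 \<otimes>\<^sub>k b1)))"
    by (simp add: tlift_def lin_ext_lin_ext flip_tensor case_prod_beta')
qed

section \<open>Group-like and skew primitive elements of a rank one Hopf algebra\<close>

text \<open>
  The coefficient of \<open>x\<^sup>i \<otimes> a\<^sup>i x\<^sup>m\<^sup>-\<^sup>i\<close> in \<open>(x \<otimes> a + 1 \<otimes> x)\<^sup>m\<close>, where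
  \<open>(1 \<otimes> x)(x \<otimes> a) = q (x \<otimes> a)(1 \<otimes> x)\<close>; a Gaussian binomial coefficient.
\<close>

fun qbinom :: "'k::field \<Rightarrow> nat \<Rightarrow> nat \<Rightarrow> 'k" where
  "qbinom q 0 i = (if i = 0 then 1 else 0)"
| "qbinom q (Suc m) i = qbinom q m i + (if i = 0 then 0 else q ^ (Suc m - i) * qbinom q m (i - 1))"

lemma qbinom_zero [simp]: "qbinom q m 0 = 1"
  by (induction m) auto

lemma qbinom_eq_zero: "m < i \<Longrightarrow> qbinom q m i = 0"
  by (induction m arbitrary: i) auto

lemma qbinom_self [simp]: "qbinom q m m = 1"
  by (induction m) (auto simp: qbinom_eq_zero)

lemma qbinom_one: "qbinom q m 1 = (\<Sum>i<m. q ^ i)"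
  by (induction m) auto

lemma mult_order_nontrivial:
  fixes q :: "'k::field"
  assumes "0 < m" "m < mult_order q"
  shows "q ^ m \<noteq> 1"
  using not_less_Least[of m "\<lambda>m. 0 < m \<and> q ^ m = 1"] assms unfolding mult_order_def by blast

text \<open>
  The number in question is \<open>(q\<^sup>m - 1)/(q - 1)\<close>. It is the reason why no power \<open>x\<^sup>m\<close> with
  \<open>2 \<le> m < n\<close> is skew primitive.
\<close>

lemma qbinom_one_nonzero:
  fixes q :: "'k::field"
  assumes "0 < m" "m < mult_order q"
  shows "qbinom q m 1 \<noteq> 0"
proof -
  have "(q - 1) * qbinom q m 1 = q ^ m - 1"
    unfolding qbinom_one by (rule power_diff_1_eq[symmetric])
  thus ?thesis using mult_order_nontrivial[OF assms] by auto
qed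

locale rank_one = 
  fixes G :: "('g, 'm) monoid_scheme" (structure)
    and \<chi> :: "'g \<Rightarrow> 'k::field" and a :: 'g and \<alpha> :: 'k
  assumes datum: "datum G \<chi> a \<alpha>"

sublocale rank_one \<subseteq> group G
  using datum by (simp add: datum_def)

context rank_one
begin

abbreviation n :: nat where "n \<equiv> mult_order (\<chi> a)"
abbreviation H :: "('g \<times> nat, 'k) bialg" where "H \<equiv> rank_one_hopf G \<chi> a \<alpha>"

definition gx :: "'g \<Rightarrow> ('g \<times> nat \<Rightarrow>\<^sub>0 'k)" where "gx g = bas (g, 1)"

abbreviation x :: "'g \<times> nat \<Rightarrow>\<^sub>0 'k" where "x \<equiv> gx \<one>"
abbreviation HH :: "(('g \<times> nat) \<times> ('g \<times> nat) \<Rightarrow>\<^sub>0 'k) set" where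
  "HH \<equiv> vs (cbasis H \<times> cbasis H)"

lemma gen_x_eq_gx [simp]: "gen_x G = x"
  by (simp add: gen_x_def gx_def)

lemma a_closed [simp]: "a \<in> carrier G"
  and a_central: "g \<in> carrier G \<Longrightarrow> a \<otimes> g = g \<otimes> a"
  and chi_mult: "g \<in> carrier G \<Longrightarrow> h \<in> carrier G \<Longrightarrow> \<chi> (g \<otimes> h) = \<chi> g * \<chi> h"
  and chi_nonzero: "g \<in> carrier G \<Longrightarrow> \<chi> g \<noteq> 0"
  and n_gt_1: "1 < n"
  using datum by (auto simp: datum_def)

lemma n_pos [simp]: "0 < n" and n_gt_Suc_0 [simp]: "Suc 0 < n"
  using n_gt_1 by auto

lemma chi_a: "\<chi> a \<noteq> 1"
  using mult_order_nontrivial[of 1 "\<chi> a"] n_gt_1 by simp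

lemma chi_one [simp]: "\<chi> \<one> = 1"
  using chi_mult[of \<one> \<one>] chi_nonzero[of \<one>] by simp

lemma a_neq_one [simp]: "a \<noteq> \<one>" "\<one> \<noteq> a"
  using chi_a by auto

lemma cbasis_H: "cbasis H = carrier G \<times> {..<n}"
  and unity_H [simp]: "unity H = grp \<one>"
  by (simp_all add: rank_one_hopf_def)

lemma grp_in_csp [simp]: "g \<in> carrier G \<Longrightarrow> grp g \<in> csp H"
  and gx_in_csp [simp]: "g \<in> carrier G \<Longrightarrow> gx g \<in> csp H"
  by (simp_all add: grp_def gx_def cbasis_H)

lemma tlift_low [simp]:
  "tlift (grp g \<otimes>\<^sub>k grp h) F = F (grp g) (grp h)" "tlift (grp g \<otimes>\<^sub>k gx h) F = F (grp g) (gx h)"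
  "tlift (gx g \<otimes>\<^sub>k grp h) F = F (gx g) (grp h)" "tlift (gx g \<otimes>\<^sub>k gx h) F = F (gx g) (gx h)"
  by (simp_all add: grp_def gx_def)

lemma lookup_grp: "Poly_Mapping.lookup (grp g) (h, i) = (if g = h \<and> i = 0 then 1 else 0)"
  and lookup_gx: "Poly_Mapping.lookup (gx g) (h, i) = (if g = h \<and> i = 1 then 1 else 0)"
  by (auto simp: grp_def gx_def lookup_bas)

lemma grp_eq_iff [simp]: "(grp g :: 'g \<times> nat \<Rightarrow>\<^sub>0 'k) = grp h \<longleftrightarrow> g = h"
proof
  assume "(grp g :: 'g \<times> nat \<Rightarrow>\<^sub>0 'k) = grp h"
  hence "Poly_Mapping.lookup (grp g :: 'g \<times> nat \<Rightarrow>\<^sub>0 'k) (g, 0) = Poly_Mapping.lookup (grp h) (g, 0)" by simp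
  thus "g = h" by (simp add: lookup_grp split: if_splits)
qed simp

lemma grp_of_grp [simp]: "g \<in> carrier G \<Longrightarrow> grp_of G (grp g :: 'g \<times> nat \<Rightarrow>\<^sub>0 'k) = g"
  unfolding grp_of_def by (rule the_inv_into_f_f) (auto intro: inj_onI)

lemma pmult_simps [simp]:
  "(u + v) \<star>\<^bsub>H\<^esub> w = u \<star>\<^bsub>H\<^esub> w + v \<star>\<^bsub>H\<^esub> w" "w \<star>\<^bsub>H\<^esub> (u + v) = w \<star>\<^bsub>H\<^esub> u + w \<star>\<^bsub>H\<^esub> v"
  "(u - v) \<star>\<^bsub>H\<^esub> w = u \<star>\<^bsub>H\<^esub> w - v \<star>\<^bsub>H\<^esub> w" "w \<star>\<^bsub>H\<^esub> (u - v) = w \<star>\<^bsub>H\<^esub> u - w \<star>\<^bsub>H\<^esub> v"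
  "(c *\<^sub>k u) \<star>\<^bsub>H\<^esub> w = c *\<^sub>k (u \<star>\<^bsub>H\<^esub> w)" "w \<star>\<^bsub>H\<^esub> (c *\<^sub>k u) = c *\<^sub>k (w \<star>\<^bsub>H\<^esub> u)"
  "0 \<star>\<^bsub>H\<^esub> w = 0" "w \<star>\<^bsub>H\<^esub> 0 = 0"
  by (auto simp: pmult_def rank_one_hopf_def H_prod_def)

lemma H_prod_bas: "H_prod G \<chi> a \<alpha> (bas (b, c)) = mono_mult G \<chi> a \<alpha> b c"
  by (simp add: H_prod_def)

lemma mono_mult_low:
  "i + j < n \<Longrightarrow> mono_mult G \<chi> a \<alpha> (g, i) (h, j) = \<chi> h ^ i *\<^sub>k bas (g \<otimes> h, i + j)"
  by (simp add: mono_mult_def Let_def)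

lemma pmult_low:
  "i + j < n \<Longrightarrow> bas (g, i) \<star>\<^bsub>H\<^esub> bas (h, j) = \<chi> h ^ i *\<^sub>k bas (g \<otimes> h, i + j)"
  by (simp add: pmult_def rank_one_hopf_def H_prod_bas mono_mult_low)

lemma grp_pmult_gx [simp]: "grp g \<star>\<^bsub>H\<^esub> gx h = gx (g \<otimes> h)"
  and gx_pmult_grp [simp]: "gx g \<star>\<^bsub>H\<^esub> grp h = \<chi> h *\<^sub>k gx (g \<otimes> h)"
  and grp_pmult_grp [simp]: "grp g \<star>\<^bsub>H\<^esub> grp h = grp (g \<otimes> h)"
  by (simp_all add: grp_def gx_def pmult_low)

lemma comult_monomial:
  assumes g: "g \<in> carrier G" and "m < n"
  shows "comult H (bas (g, m)) =
    (\<Sum>i\<le>m. qbinom (\<chi> a) m i *\<^sub>k bas ((g, i), (g \<otimes> a [^] i, m - i)))"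
proof -
  define step where "step = (\<lambda>t. H2_mult G \<chi> a \<alpha> t (gen_x G \<otimes>\<^sub>k grp a + grp \<one> \<otimes>\<^sub>k gen_x G))"
  have lin: "step (u + v) = step u + step v" "step (c *\<^sub>k v) = c *\<^sub>k step v" "step 0 = 0" for u v c
    by (simp_all add: step_def H2_mult_def)
  have step_sum: "step (\<Sum>i\<in>I. f i) = (\<Sum>i\<in>I. step (f i))" if "finite I" for I :: "nat set" and f
    using that by (induction I) (simp_all add: lin)
  have step_bas: "step (bas ((g, i), (h, j))) =
      \<chi> a ^ j *\<^sub>k bas ((g, Suc i), (h \<otimes> a, j)) + bas ((g, i), (h, Suc j))"
    if "h \<in> carrier G" "Suc (i + j) < n" for h i j
    using that g
    by (simp add: step_def H2_mult_def gx_def grp_def H_prod_bas mono_mult_low)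
  have "(step ^^ m) (bas ((g, 0), (g, 0))) =
      (\<Sum>i\<le>m. qbinom (\<chi> a) m i *\<^sub>k bas ((g, i), (g \<otimes> a [^] i, m - i)))"
    using assms(2)
  proof (induction m)
    case (Suc m)
    let ?q = "qbinom (\<chi> a)" and ?b = "\<lambda>i. bas ((g, i), (g \<otimes> a [^] i, Suc m - i)) :: _ \<Rightarrow>\<^sub>0 'k"
    have "(step ^^ Suc m) (bas ((g, 0), (g, 0))) =
        (\<Sum>i\<le>m. ?q m i *\<^sub>k step (bas ((g, i), (g \<otimes> a [^] i, m - i))))"
      using Suc by (simp add: step_sum lin)
    also have "\<dots> = (\<Sum>i\<le>m. ?q m i *\<^sub>k (\<chi> a ^ (m - i) *\<^sub>k ?b (Suc i) + ?b i))"
      using g Suc.prems by (intro sum.cong refl) (simp add: step_bas m_assoc Suc_diff_le)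
    also have "\<dots> = (\<Sum>i\<le>m. (\<chi> a ^ (m - i) * ?q m i) *\<^sub>k ?b (Suc i)) + (\<Sum>i\<le>m. ?q m i *\<^sub>k ?b i)"
      by (simp add: sum.distrib mult.commute)
    also have "(\<Sum>i\<le>m. ?q m i *\<^sub>k ?b i) = (\<Sum>i\<le>Suc m. ?q m i *\<^sub>k ?b i)"
      by (simp add: qbinom_eq_zero)
    also have "(\<Sum>i\<le>m. (\<chi> a ^ (m - i) * ?q m i) *\<^sub>k ?b (Suc i)) =
        (\<Sum>i\<le>Suc m. (if i = 0 then 0 else \<chi> a ^ (Suc m - i) * ?q m (i - 1)) *\<^sub>k ?b i)"
      by (simp only: sum.atMost_Suc_shift) simp
    finally show ?case
      by (simp add: sum.distrib[symmetric] scal_add_left[symmetric] add.commute del: sum.atMost_Suc)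
  qed (use g in simp)
  thus ?thesis by (simp add: rank_one_hopf_def H_comult_def step_def grp_def)
qed

lemma comult_grp [simp]: "g \<in> carrier G \<Longrightarrow> comult H (grp g) = grp g \<otimes>\<^sub>k grp g"
  by (simp add: grp_def comult_monomial)

lemma comult_gx [simp]:
  "g \<in> carrier G \<Longrightarrow> comult H (gx g) = gx g \<otimes>\<^sub>k grp (g \<otimes> a) + grp g \<otimes>\<^sub>k gx g"
  by (simp add: grp_def gx_def comult_monomial)

text \<open>
  With all coefficients of \<open>\<Delta>(v)\<close> explicit, group-like and skew primitive elements can be found
  by comparing coefficients.
\<close>

lemma lookup_comult:
  assumes "v \<in> csp H"
  shows "Poly_Mapping.lookup (comult H v) ((g, i), (h, j)) =
    (if h = g \<otimes> a [^] i then qbinom (\<chi> a) (i + j) i * Poly_Mapping.lookup v (g, i + j) else 0)"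
proof -
  have lin: "comult H (u + v) = comult H u + comult H v" "comult H (c *\<^sub>k v) = c *\<^sub>k comult H v"
    "comult H 0 = 0" for u v c
    by (simp_all add: rank_one_hopf_def H_comult_def)
  have bas: "Poly_Mapping.lookup (comult H (bas b)) ((g, i), (h, j)) =
    (if h = g \<otimes> a [^] i then qbinom (\<chi> a) (i + j) i * Poly_Mapping.lookup (bas b) (g, i + j) else 0)"
    if b: "b \<in> cbasis H" for b
  proof -
    obtain g' m where b': "b = (g', m)" and that: "g' \<in> carrier G" "m < n" using b by (auto simp: cbasis_H)
    have "Poly_Mapping.lookup (comult H (bas (g', m))) ((g, i), (h, j)) =
      (\<Sum>i'\<le>m. if i' = i then (if g' = g \<and> m = i + j \<and> h = g \<otimes> a [^] i then qbinom (\<chi> a) m i else 0) else 0)"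
      unfolding comult_monomial[OF that] lookup_sum
      by (intro sum.cong) (auto simp: lookup_bas)
    thus ?thesis by (auto simp: lookup_bas b')
  qed
  show ?thesis using assms
    by (induction rule: vs_induct) (simp_all add: lin lookup_add bas distrib_left mult.left_commute)
qed

lemma counit_simps [simp]:
  "counit H (grp g) = 1" "counit H (gx g) = 0"
  by (simp_all add: rank_one_hopf_def H_counit_def grp_def gx_def bas_def)

text \<open>
  The coproduct preserves the degree in \<open>x\<close>, whereas \<open>v \<otimes> v\<close> has twice the degree of \<open>v\<close>; so \<open>v\<close>
  has degree zero, and its coefficients satisfy \<open>v\<^sub>g v\<^sub>h = 0\<close> for \<open>g \<noteq> h\<close> and \<open>v\<^sub>g\<^sup>2 = v\<^sub>g\<close>.
\<close>

lemma grouplike_is_grp: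
  assumes v: "v \<in> csp H" and gl: "comult H v = v \<otimes>\<^sub>k v" and "v \<noteq> 0"
  obtains g where "g \<in> carrier G" "v = grp g"
proof -
  let ?l = "Poly_Mapping.lookup v"
  have eq: "?l (g, i) * ?l (h, j) =
      (if h = g \<otimes> a [^] i then qbinom (\<chi> a) (i + j) i * ?l (g, i + j) else 0)" for g h i j
    using lookup_comult[OF v, of g i h j] unfolding gl lookup_tensor by simp
  have deg0: "?l (g, i) = 0" if "0 < i" for g i
  proof (rule ccontr)
    assume "?l (g, i) \<noteq> 0"
    have fin: "finite {i. \<exists>g. ?l (g, i) \<noteq> 0}"
    proof (rule finite_subset)
      show "{i. \<exists>g. ?l (g, i) \<noteq> 0} \<subseteq> snd ` Poly_Mapping.keys v"
        by (force simp: in_keys_iff)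
    qed simp
    define m where "m = Max {i. \<exists>g. ?l (g, i) \<noteq> 0}"
    have "m \<in> {i. \<exists>g. ?l (g, i) \<noteq> 0}"
      unfolding m_def using fin \<open>?l (g, i) \<noteq> 0\<close> by (intro Max_in) auto
    then obtain h where h: "?l (h, m) \<noteq> 0" by blast
    have "i \<le> m" unfolding m_def using fin \<open>?l (g, i) \<noteq> 0\<close> by (intro Max_ge) auto
    have "?l (h, m + m) = 0"
    proof (rule ccontr)
      assume "?l (h, m + m) \<noteq> 0"
      hence "m + m \<le> m" unfolding m_def[symmetric] using fin
        by (subst (3) m_def, intro Max_ge) auto
      thus False using \<open>i \<le> m\<close> \<open>0 < i\<close> by simp
    qed
    thus False using eq[of h m h m] h by (simp split: if_splits)
  qed
  obtain b where b: "?l b \<noteq> 0" using \<open>v \<noteq> 0\<close> by (metis poly_mapping_eqI lookup_zero)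
  then obtain g where g: "?l (g, 0) \<noteq> 0" using deg0 by (metis neq0_conv surj_pair)
  hence gG: "g \<in> carrier G" using lookup_outside[OF v, of "(g, 0)"] by (auto simp: cbasis_H)
  have "?l (g, 0) = 1" using eq[of g 0 g 0] g gG by simp
  moreover have "?l (h, 0) = 0" if "h \<noteq> g" for h
    using eq[of g 0 h 0] that g gG by simp
  ultimately have "?l (h, i) = Poly_Mapping.lookup (grp g) (h, i)" for h i
    using deg0[of i h] by (cases "i = 0"; cases "h = g") (auto simp: grp_def lookup_bas)
  hence "v = grp g" by (intro poly_mapping_eqI) (metis surj_pair)
  thus thesis using that gG by blast
qed

text \<open>
  A term \<open>gx\<^sup>m\<close> with \<open>m \<ge> 2\<close> would contribute a nonzero multiple of
  \<open>gx \<otimes> gax\<^sup>m\<^sup>-\<^sup>1\<close>, which \<open>v \<otimes> b + 1 \<otimes> v\<close> does not contain.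
\<close>

lemma skew_primitive:
  assumes v: "v \<in> csp H" and b: "b \<in> carrier G"
    and sp: "comult H v = v \<otimes>\<^sub>k grp b + grp \<one> \<otimes>\<^sub>k v"
  obtains l m where "v = l *\<^sub>k x + m *\<^sub>k (grp \<one> - grp b)" "l \<noteq> 0 \<Longrightarrow> b = a"
proof -
  let ?l = "Poly_Mapping.lookup v"
  have eq: "?l (g, i) * (if (b, 0) = (h, j) then 1 else 0) + (if (\<one>, 0) = (g, i) then 1 else 0) * ?l (h, j) =
      (if h = g \<otimes> a [^] i then qbinom (\<chi> a) (i + j) i * ?l (g, i + j) else 0)" for g h i j
    using lookup_comult[OF v, of g i h j] unfolding sp lookup_add lookup_tensor grp_def lookup_bas .
  have out: "?l (g, i) = 0" if "g \<notin> carrier G \<or> n \<le> i" for g i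
    using lookup_outside[OF v, of "(g, i)"] that by (auto simp: cbasis_H)
  have deg2: "?l (g, i) = 0" if "2 \<le> i" for g i
  proof (cases "g \<in> carrier G \<and> i < n")
    case True
    have "qbinom (\<chi> a) i 1 \<noteq> 0" using True that by (intro qbinom_one_nonzero) auto
    thus ?thesis using eq[of g 1 "g \<otimes> a" "i - 1"] that True by auto
  qed (use out in auto)
  have deg1: "?l (g, 1) = 0" if "g \<noteq> \<one>" for g
  proof (cases "g \<in> carrier G")
    case True
    thus ?thesis using eq[of g 0 g 1] that by simp
  qed (use out in auto)
  have deg1': "?l (\<one>, 1) = 0" if "b \<noteq> a"
    using eq[of \<one> 1 a 0] that by auto
  have deg0: "?l (g, 0) = 0" if "g \<noteq> \<one>" "g \<noteq> b" for g
  proof (cases "g \<in> carrier G")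
    case True
    thus ?thesis using eq[of g 0 g 0] that by simp
  qed (use out in auto)
  have deg0': "?l (b, 0) = - ?l (\<one>, 0)" if "b \<noteq> \<one>"
    using eq[of \<one> 0 b 0] that b by (auto simp: eq_neg_iff_add_eq_0 add.commute)
  have deg0'': "?l (\<one>, 0) = 0" if "b = \<one>"
  proof -
    have "(2 :: 'k) \<noteq> 1" by (metis one_add_one add_cancel_right_left one_neq_zero)
    thus ?thesis using eq[of \<one> 0 \<one> 0] that by simp
  qed
  have "?l (g, i) = Poly_Mapping.lookup (?l (\<one>, 1) *\<^sub>k x + ?l (\<one>, 0) *\<^sub>k (grp \<one> - grp b)) (g, i)" for g i
  proof -
    have rhs: "Poly_Mapping.lookup (?l (\<one>, 1) *\<^sub>k x + ?l (\<one>, 0) *\<^sub>k (grp \<one> - grp b)) (g, i) =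
      (if g = \<one> \<and> i = 1 then ?l (\<one>, 1) else 0) + (if g = \<one> \<and> i = 0 then ?l (\<one>, 0) else 0)
      - (if g = b \<and> i = 0 then ?l (\<one>, 0) else 0)"
      unfolding lookup_add lookup_scal lookup_minus lookup_bas gx_def grp_def by auto
    consider "2 \<le> i" | "i = 1" | "i = 0" by linarith
    thus ?thesis
    proof cases
      case 1
      thus ?thesis unfolding rhs using deg2[of i g] by simp
    next
      case 2
      thus ?thesis unfolding rhs using deg1[of g] by (cases "g = \<one>") simp_all
    next
      case 3
      thus ?thesis unfolding rhs using deg0[of g] deg0' deg0''
        by (cases "g = \<one>"; cases "g = b") simp_all
    qed
  qed
  hence "v = ?l (\<one>, 1) *\<^sub>k x + ?l (\<one>, 0) *\<^sub>k (grp \<one> - grp b)"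
    by (intro poly_mapping_eqI) (metis surj_pair)
  thus thesis using that deg1' by blast
qed

end

section \<open>Actions of the group on a rank one Hopf algebra\<close>

text \<open>
  The properties that \<open>\<cdot>\<close> and \<open>\<Colon>\<close> have in common.
\<close>

locale rank_one_action = rank_one G \<chi> a \<alpha>
  for G :: "('g, 'm) monoid_scheme" (structure) and \<chi> :: "'g \<Rightarrow> 'k::field" and a \<alpha> +
  fixes f :: "(('g \<times> nat) \<times> ('g \<times> nat) \<Rightarrow>\<^sub>0 'k) \<Rightarrow> ('g \<times> nat \<Rightarrow>\<^sub>0 'k)"
  assumes linear: "linear_on (cbasis H \<times> cbasis H) (cbasis H) f"
    and counit: "u \<in> csp H \<Longrightarrow> v \<in> csp H \<Longrightarrow> counit H (f (u \<otimes>\<^sub>k v)) = counit H u * counit H v"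
    and comult_grp_grp: "h \<in> carrier G \<Longrightarrow> g \<in> carrier G \<Longrightarrow>
      comult H (f (grp h \<otimes>\<^sub>k grp g)) = f (grp h \<otimes>\<^sub>k grp g) \<otimes>\<^sub>k f (grp h \<otimes>\<^sub>k grp g)"
    and comult_x_grp: "g \<in> carrier G \<Longrightarrow> comult H (f (x \<otimes>\<^sub>k grp g)) =
      f (x \<otimes>\<^sub>k grp g) \<otimes>\<^sub>k f (grp a \<otimes>\<^sub>k grp g) + f (grp \<one> \<otimes>\<^sub>k grp g) \<otimes>\<^sub>k f (x \<otimes>\<^sub>k grp g)"
    and act_unity: "u \<in> csp H \<Longrightarrow> f (u \<otimes>\<^sub>k grp \<one>) = u"
    and act_pmult: "u \<in> csp H \<Longrightarrow> v \<in> csp H \<Longrightarrow> w \<in> csp H \<Longrightarrow>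
      f (u \<otimes>\<^sub>k (v \<star>\<^bsub>H\<^esub> w)) = f (f (u \<otimes>\<^sub>k w) \<otimes>\<^sub>k v)"
begin

lemma act_closed [simp]: "t \<in> HH \<Longrightarrow> f t \<in> csp H"
  and act_add [simp]: "s \<in> HH \<Longrightarrow> t \<in> HH \<Longrightarrow> f (s + t) = f s + f t"
  and act_scal [simp]: "t \<in> HH \<Longrightarrow> f (c *\<^sub>k t) = c *\<^sub>k f t"
  and act_zero [simp]: "f 0 = 0"
  by (rule linear_onD[OF linear]; assumption)+

lemma act_diff [simp]:
  assumes "s \<in> HH" "t \<in> HH"
  shows "f (s - t) = f s - f t"
  using act_add[of "s - t" t] assms by (simp del: act_add)

definition grp_act :: "'g \<Rightarrow> 'g \<Rightarrow> 'g" where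
  "grp_act h g = grp_of G (f (grp h \<otimes>\<^sub>k grp g))"

lemma grp_act_closed [simp]: "h \<in> carrier G \<Longrightarrow> g \<in> carrier G \<Longrightarrow> grp_act h g \<in> carrier G"
  and act_grp_grp [simp]: "h \<in> carrier G \<Longrightarrow> g \<in> carrier G \<Longrightarrow> f (grp h \<otimes>\<^sub>k grp g) = grp (grp_act h g)"
proof -
  assume hg: "h \<in> carrier G" "g \<in> carrier G"
  have "counit H (f (grp h \<otimes>\<^sub>k grp g)) = 1" using hg by (simp add: counit)
  moreover have "counit H 0 = 0" by (simp add: rank_one_hopf_def H_counit_def)
  ultimately have "f (grp h \<otimes>\<^sub>k grp g) \<noteq> 0" by auto
  then obtain e where "e \<in> carrier G" "f (grp h \<otimes>\<^sub>k grp g) = grp e"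
    using hg by (elim grouplike_is_grp[OF _ comult_grp_grp, rotated -1]) auto
  thus "grp_act h g \<in> carrier G" "f (grp h \<otimes>\<^sub>k grp g) = grp (grp_act h g)"
    by (simp_all add: grp_act_def)
qed

lemma grp_act_one [simp]: "h \<in> carrier G \<Longrightarrow> grp_act h \<one> = h"
  using act_unity[of "grp h"] by simp

lemma grp_act_mult:
  assumes "h \<in> carrier G" "k \<in> carrier G" "l \<in> carrier G"
  shows "grp_act h (k \<otimes> l) = grp_act (grp_act h l) k"
  using act_pmult[of "grp h" "grp k" "grp l"] assms by simp

lemma grp_act_inv:
  assumes "h \<in> carrier G" "g \<in> carrier G"
  shows "grp_act (grp_act h (inv g)) g = h" "grp_act (grp_act h g) (inv g) = h"
  using assms by (simp_all add: grp_act_mult[symmetric])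

end

locale pointed_rank_one_action = rank_one_action G \<chi> a \<alpha> f
  for G :: "('g, 'm) monoid_scheme" (structure) and \<chi> :: "'g \<Rightarrow> 'k::field" and a \<alpha> f +
  assumes one_grp_act: "g \<in> carrier G \<Longrightarrow> grp_act \<one> g = \<one>"
begin

definition x_coeff :: "'g \<Rightarrow> 'k" where
  "x_coeff g = Poly_Mapping.lookup (f (x \<otimes>\<^sub>k grp g)) (\<one>, 1)"

definition grp_coeff :: "'g \<Rightarrow> 'k" where
  "grp_coeff g = Poly_Mapping.lookup (f (x \<otimes>\<^sub>k grp g)) (\<one>, 0)"

text \<open>
  If the coefficient of \<open>x\<close> vanished, the image of \<open>x\<close> would be a multiple of \<open>1 - a \<cdot> g\<close>, that
  is, of the image of \<open>1 - a\<close>, contradicting the injectivity of the action of \<open>g\<close>.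
\<close>

lemma x_act_grp:
  assumes g: "g \<in> carrier G"
  shows "f (x \<otimes>\<^sub>k grp g) = x_coeff g *\<^sub>k x + grp_coeff g *\<^sub>k (grp \<one> - grp a)"
    and x_coeff_nonzero: "x_coeff g \<noteq> 0"
    and a_grp_act: "grp_act a g = a"
proof -
  obtain l m where lm: "f (x \<otimes>\<^sub>k grp g) = l *\<^sub>k x + m *\<^sub>k (grp \<one> - grp (grp_act a g))"
    and la: "l \<noteq> 0 \<Longrightarrow> grp_act a g = a"
    using g comult_x_grp[OF g] one_grp_act[OF g]
    by (elim skew_primitive[of "f (x \<otimes>\<^sub>k grp g)" "grp_act a g", rotated -1]) auto
  have "l \<noteq> 0"
  proof
    assume "l = 0"
    hence "f (x \<otimes>\<^sub>k grp g) = m *\<^sub>k (grp \<one> - grp (grp_act a g))" by (simp add: lm)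
    hence "f (f (x \<otimes>\<^sub>k grp g) \<otimes>\<^sub>k grp (inv g)) = m *\<^sub>k (grp \<one> - grp a)"
      using g by (simp add: one_grp_act grp_act_inv)
    moreover have "f (f (x \<otimes>\<^sub>k grp g) \<otimes>\<^sub>k grp (inv g)) = x"
      using act_pmult[of x "grp (inv g)" "grp g"] g by (simp add: act_unity)
    ultimately have "Poly_Mapping.lookup x (\<one>, 1) =
        Poly_Mapping.lookup (m *\<^sub>k (grp \<one> - grp a)) (\<one>, 1)" by simp
    thus False by (simp add: lookup_gx lookup_grp lookup_minus)
  qed
  hence a: "grp_act a g = a" by (rule la)
  have "x_coeff g = l" "grp_coeff g = m"
    unfolding x_coeff_def grp_coeff_def lm a
    by (simp_all add: lookup_add lookup_minus lookup_gx lookup_grp)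
  thus "f (x \<otimes>\<^sub>k grp g) = x_coeff g *\<^sub>k x + grp_coeff g *\<^sub>k (grp \<one> - grp a)"
    "x_coeff g \<noteq> 0" "grp_act a g = a"
    using \<open>l \<noteq> 0\<close> a lm by simp_all
qed

lemma grp_coeff_mult:
  assumes "k \<in> carrier G" "l \<in> carrier G"
  shows "grp_coeff (k \<otimes> l) = x_coeff l * grp_coeff k + grp_coeff l"
proof -
  have "f (x \<otimes>\<^sub>k grp (k \<otimes> l)) = f (f (x \<otimes>\<^sub>k grp l) \<otimes>\<^sub>k grp k)"
    using act_pmult[of x "grp k" "grp l"] assms by simp
  hence "Poly_Mapping.lookup (f (x \<otimes>\<^sub>k grp (k \<otimes> l))) (\<one>, 0) =
      Poly_Mapping.lookup (f (f (x \<otimes>\<^sub>k grp l) \<otimes>\<^sub>k grp k)) (\<one>, 0)" by simp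
  thus ?thesis using assms
    by (simp add: x_act_grp one_grp_act a_grp_act lookup_add lookup_minus lookup_gx lookup_grp)
qed

text \<open>
  Evaluating the cocycle rule \<open>grp_coeff_mult\<close> at \<open>ag = ga\<close> gives
  \<open>(c\<^sub>a - 1) m\<^sub>g = (c\<^sub>g - 1) m\<^sub>a\<close>.
\<close>

lemma grp_coeff_eq_zero:
  assumes "grp_coeff a = 0" "x_coeff a \<noteq> 1" and g: "g \<in> carrier G"
  shows "grp_coeff g = 0"
proof -
  have "grp_coeff g = x_coeff a * grp_coeff g"
    using grp_coeff_mult[of a g] grp_coeff_mult[of g a] assms by (simp add: a_central)
  thus ?thesis using assms(2) by auto
qed

end

section \<open>Hopf q-braces with nonzero square of x\<close>

locale rank_one_brace = rank_one G \<chi> a \<alpha>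
  for G :: "('g, 'm) monoid_scheme" (structure) and \<chi> :: "'g \<Rightarrow> 'k::field" and a \<alpha> +
  fixes p d :: "(('g \<times> nat) \<times> ('g \<times> nat) \<Rightarrow>\<^sub>0 'k) \<Rightarrow> ('g \<times> nat \<Rightarrow>\<^sub>0 'k)" and lam :: 'k
  assumes brace: "hopf_q_brace p d H"
    and lam: "lam \<noteq> 0"
    and x_dot_x: "p (x \<otimes>\<^sub>k x) = lam *\<^sub>k (grp \<one> - grp a)"
begin

lemma magma: "q_magma_coalgebra p d H"
  using brace by (simp add: hopf_q_brace_def q_cycle_coalgebra_def)

lemma mem_cbasis [simp]: "g \<in> carrier G \<Longrightarrow> (g, 0) \<in> cbasis H"
  "g \<in> carrier G \<Longrightarrow> (g, Suc 0) \<in> cbasis H"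
  by (simp_all add: cbasis_H)

lemma comult_dot_grp:
  assumes "g \<in> carrier G"
  shows "h \<in> carrier G \<Longrightarrow> comult H (p (grp h \<otimes>\<^sub>k grp g)) = p (grp h \<otimes>\<^sub>k grp g) \<otimes>\<^sub>k p (grp h \<otimes>\<^sub>k grp g)"
    and "comult H (p (x \<otimes>\<^sub>k grp g)) =
      p (x \<otimes>\<^sub>k grp g) \<otimes>\<^sub>k p (grp a \<otimes>\<^sub>k grp g) + p (grp \<one> \<otimes>\<^sub>k grp g) \<otimes>\<^sub>k p (x \<otimes>\<^sub>k grp g)"
  using q_magma_comult_dot[OF magma, folded grp_def, of "(h, 0)" "(g, 0)"]
    q_magma_comult_dot[OF magma, of "(\<one>, 1)" "(g, 0)", folded grp_def gx_def] assms
  by (simp_all flip: grp_def gx_def)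

lemma comult_col_grp:
  assumes "g \<in> carrier G"
  shows "h \<in> carrier G \<Longrightarrow> comult H (d (grp h \<otimes>\<^sub>k grp g)) = d (grp h \<otimes>\<^sub>k grp g) \<otimes>\<^sub>k d (grp h \<otimes>\<^sub>k grp g)"
    and "comult H (d (x \<otimes>\<^sub>k grp g)) =
      d (x \<otimes>\<^sub>k grp g) \<otimes>\<^sub>k d (grp a \<otimes>\<^sub>k grp g) + d (grp \<one> \<otimes>\<^sub>k grp g) \<otimes>\<^sub>k d (x \<otimes>\<^sub>k grp g)"
  using q_magma_comult_col[OF magma, of "(g, 0)" "(h, 0)", folded grp_def gx_def]
    q_magma_comult_col[OF magma, of "(g, 0)" "(\<one>, 1)", folded grp_def gx_def] assms
  by (simp_all flip: grp_def gx_def)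

end

sublocale rank_one_brace \<subseteq> dot: rank_one_action G \<chi> a \<alpha> p
  using brace comult_dot_grp
  by unfold_locales (auto simp: hopf_q_brace_def q_cycle_coalgebra_def q_magma_coalgebra_def)

sublocale rank_one_brace \<subseteq> col: rank_one_action G \<chi> a \<alpha> d
  using brace comult_col_grp
  by unfold_locales (auto simp: hopf_q_brace_def q_cycle_coalgebra_def q_magma_coalgebra_def)

context rank_one_brace
begin

lemma pmult_dot:
  assumes "h \<in> csp H" "k \<in> csp H" "l \<in> csp H"
  shows "p ((h \<star>\<^bsub>H\<^esub> k) \<otimes>\<^sub>k l) = tlift (comult H k) (\<lambda>k1 k2. tlift (comult H l) (\<lambda>l1 l2.
    p (h \<otimes>\<^sub>k d (l1 \<otimes>\<^sub>k k2)) \<star>\<^bsub>H\<^esub> p (k1 \<otimes>\<^sub>k l2)))"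
  using brace assms unfolding hopf_q_brace_def by blast

lemma pmult_col:
  assumes "h \<in> csp H" "k \<in> csp H" "l \<in> csp H"
  shows "d ((h \<star>\<^bsub>H\<^esub> k) \<otimes>\<^sub>k l) = tlift (comult H k) (\<lambda>k1 k2. tlift (comult H l) (\<lambda>l1 l2.
    d (h \<otimes>\<^sub>k p (l1 \<otimes>\<^sub>k k2)) \<star>\<^bsub>H\<^esub> d (k1 \<otimes>\<^sub>k l2)))"
  using brace assms unfolding hopf_q_brace_def by blast

end

sublocale rank_one_brace \<subseteq> dot: pointed_rank_one_action G \<chi> a \<alpha> p
proof
  fix g assume g: "g \<in> carrier G"
  have "dot.grp_act \<one> g = dot.grp_act \<one> g \<otimes> dot.grp_act \<one> g"
    using pmult_dot[of "grp \<one>" "grp \<one>" "grp g"] g by simp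
  thus "dot.grp_act \<one> g = \<one>" using g by simp
qed

sublocale rank_one_brace \<subseteq> col: pointed_rank_one_action G \<chi> a \<alpha> d
proof
  fix g assume g: "g \<in> carrier G"
  have "col.grp_act \<one> g = col.grp_act \<one> g \<otimes> col.grp_act \<one> g"
    using pmult_col[of "grp \<one>" "grp \<one>" "grp g"] g by simp
  thus "col.grp_act \<one> g = \<one>" using g by simp
qed

context rank_one_brace
begin

subsection \<open>The values of the two operations\<close>

lemmas grp_act_simps [simp] =
  dot.one_grp_act col.one_grp_act dot.a_grp_act col.a_grp_act

lemma tensor_one_eq_tensor_a_imp_zero:
  assumes "grp \<one> \<otimes>\<^sub>k v = grp a \<otimes>\<^sub>k v \<or> v \<otimes>\<^sub>k grp \<one> = v \<otimes>\<^sub>k grp a"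
  shows "v = (0 :: 'g \<times> nat \<Rightarrow>\<^sub>0 'k)"
proof (rule poly_mapping_eqI)
  fix e :: "'g \<times> nat"
  from assms show "Poly_Mapping.lookup v e = Poly_Mapping.lookup 0 e"
  proof
    assume "grp \<one> \<otimes>\<^sub>k v = grp a \<otimes>\<^sub>k v"
    hence "Poly_Mapping.lookup (grp \<one> \<otimes>\<^sub>k v) ((\<one>, 0), e) = Poly_Mapping.lookup (grp a \<otimes>\<^sub>k v) ((\<one>, 0), e)" by simp
    thus ?thesis by (simp add: lookup_tensor lookup_grp)
  next
    assume "v \<otimes>\<^sub>k grp \<one> = v \<otimes>\<^sub>k grp a"
    hence "Poly_Mapping.lookup (v \<otimes>\<^sub>k grp \<one>) (e, (\<one>, 0)) = Poly_Mapping.lookup (v \<otimes>\<^sub>k grp a) (e, (\<one>, 0))" by simp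
    thus ?thesis by (simp add: lookup_tensor lookup_grp)
  qed
qed

text \<open>
  The compatibility of the two operations at \<open>h \<otimes> x\<close> reads
  \<open>(x \<Colon> h) \<otimes> (h \<cdot> a - h) = (a - 1) \<otimes> (h \<cdot> x)\<close>, and \<open>x \<Colon> h\<close> has a nonzero component along
  \<open>x\<close> while \<open>a - 1\<close> has none.
\<close>

lemma grp_dot_a [simp]: "h \<in> carrier G \<Longrightarrow> dot.grp_act h a = h"
  and grp_dot_x [simp]: "h \<in> carrier G \<Longrightarrow> p (grp h \<otimes>\<^sub>k x) = 0"
proof -
  assume h: "h \<in> carrier G"
  have eq: "d (x \<otimes>\<^sub>k grp h) \<otimes>\<^sub>k grp (dot.grp_act h a) + grp \<one> \<otimes>\<^sub>k p (grp h \<otimes>\<^sub>k x) =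
      grp a \<otimes>\<^sub>k p (grp h \<otimes>\<^sub>k x) + d (x \<otimes>\<^sub>k grp h) \<otimes>\<^sub>k grp h"
    using q_magma_compat[OF magma, of "(h, 0)" "(\<one>, 1)", folded grp_def gx_def] h by simp
  hence "Poly_Mapping.lookup (d (x \<otimes>\<^sub>k grp h) \<otimes>\<^sub>k grp (dot.grp_act h a) + grp \<one> \<otimes>\<^sub>k p (grp h \<otimes>\<^sub>k x))
      ((\<one>, 1), (dot.grp_act h a, 0)) = Poly_Mapping.lookup
      (grp a \<otimes>\<^sub>k p (grp h \<otimes>\<^sub>k x) + d (x \<otimes>\<^sub>k grp h) \<otimes>\<^sub>k grp h) ((\<one>, 1), (dot.grp_act h a, 0))"
    by simp
  hence "col.x_coeff h = (if h = dot.grp_act h a then col.x_coeff h else 0)"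
    using h by (simp add: lookup_add lookup_minus lookup_tensor lookup_grp lookup_gx col.x_act_grp
        split: if_splits)
  thus a: "dot.grp_act h a = h" using col.x_coeff_nonzero[OF h] by (auto split: if_splits)
  show "p (grp h \<otimes>\<^sub>k x) = 0" using eq by (intro tensor_one_eq_tensor_a_imp_zero) (simp add: a)
qed

text \<open>
  The same argument with the compatibility at \<open>x \<otimes> h\<close>.
\<close>

lemma grp_col_a [simp]: "h \<in> carrier G \<Longrightarrow> col.grp_act h a = h"
  and grp_col_x [simp]: "h \<in> carrier G \<Longrightarrow> d (grp h \<otimes>\<^sub>k x) = 0"
proof -
  assume h: "h \<in> carrier G"
  have eq: "grp (col.grp_act h a) \<otimes>\<^sub>k p (x \<otimes>\<^sub>k grp h) + d (grp h \<otimes>\<^sub>k x) \<otimes>\<^sub>k grp \<one> =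
      d (grp h \<otimes>\<^sub>k x) \<otimes>\<^sub>k grp a + grp h \<otimes>\<^sub>k p (x \<otimes>\<^sub>k grp h)"
    using q_magma_compat[OF magma, of "(\<one>, 1)" "(h, 0)", folded grp_def gx_def] h by simp
  hence "Poly_Mapping.lookup (grp (col.grp_act h a) \<otimes>\<^sub>k p (x \<otimes>\<^sub>k grp h) + d (grp h \<otimes>\<^sub>k x) \<otimes>\<^sub>k grp \<one>)
      ((col.grp_act h a, 0), (\<one>, 1)) = Poly_Mapping.lookup
      (d (grp h \<otimes>\<^sub>k x) \<otimes>\<^sub>k grp a + grp h \<otimes>\<^sub>k p (x \<otimes>\<^sub>k grp h)) ((col.grp_act h a, 0), (\<one>, 1))"
    by simp
  hence "dot.x_coeff h = (if h = col.grp_act h a then dot.x_coeff h else 0)"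
    using h by (simp add: lookup_add lookup_minus lookup_tensor lookup_grp lookup_gx dot.x_act_grp
        split: if_splits)
  thus a: "col.grp_act h a = h" using dot.x_coeff_nonzero[OF h] by (auto split: if_splits)
  show "d (grp h \<otimes>\<^sub>k x) = 0" using eq by (intro tensor_one_eq_tensor_a_imp_zero) (simp add: a)
qed

text \<open>
  With the previous results, the compatibility at \<open>x \<otimes> x\<close> becomes
  \<open>(x \<Colon> x + \<lambda>(1 - a)) \<otimes> (a - 1) = (x \<Colon> a) \<otimes> (x \<cdot> a) - x \<otimes> x\<close>; its coefficients give the three
  claims.
\<close>

lemma compat_x_x:
  shows "dot.x_coeff a * col.x_coeff a = 1" and "col.grp_coeff a = 0"
    and "d (x \<otimes>\<^sub>k x) = (- lam) *\<^sub>k (grp \<one> - grp a) - (dot.grp_coeff a * col.x_coeff a) *\<^sub>k x"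
proof -
  have eq: "d (x \<otimes>\<^sub>k grp a) \<otimes>\<^sub>k p (x \<otimes>\<^sub>k grp a) + grp \<one> \<otimes>\<^sub>k p (x \<otimes>\<^sub>k x) + d (x \<otimes>\<^sub>k x) \<otimes>\<^sub>k grp \<one> =
      d (x \<otimes>\<^sub>k x) \<otimes>\<^sub>k grp a + grp a \<otimes>\<^sub>k p (x \<otimes>\<^sub>k x) + x \<otimes>\<^sub>k x"
    using q_magma_compat[OF magma, of "(\<one>, 1)" "(\<one>, 1)", folded grp_def gx_def]
    by (simp add: dot.act_unity col.act_unity add_ac)
  have coeff: "Poly_Mapping.lookup (d (x \<otimes>\<^sub>k grp a)) e * Poly_Mapping.lookup (p (x \<otimes>\<^sub>k grp a)) e' +
      Poly_Mapping.lookup (grp \<one>) e * Poly_Mapping.lookup (p (x \<otimes>\<^sub>k x)) e' +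
      Poly_Mapping.lookup (d (x \<otimes>\<^sub>k x)) e * Poly_Mapping.lookup (grp \<one>) e' =
      Poly_Mapping.lookup (d (x \<otimes>\<^sub>k x)) e * Poly_Mapping.lookup (grp a) e' +
      Poly_Mapping.lookup (grp a) e * Poly_Mapping.lookup (p (x \<otimes>\<^sub>k x)) e' +
      Poly_Mapping.lookup x e * Poly_Mapping.lookup x e'" for e e'
    using arg_cong[OF eq, of "\<lambda>t. Poly_Mapping.lookup t (e, e')"]
    by (simp only: lookup_add lookup_tensor)
  note lookups = lookup_add lookup_minus lookup_grp lookup_gx dot.x_act_grp col.x_act_grp x_dot_x
  show 1: "dot.x_coeff a * col.x_coeff a = 1"
    using coeff[of "(\<one>, 1)" "(\<one>, 1)"] by (simp add: lookups mult.commute)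
  show 2: "col.grp_coeff a = 0"
    using coeff[of "(\<one>, 0)" "(\<one>, 1)"] 1 by (auto simp: lookups)
  show "d (x \<otimes>\<^sub>k x) = (- lam) *\<^sub>k (grp \<one> - grp a) - (dot.grp_coeff a * col.x_coeff a) *\<^sub>k x"
  proof (rule poly_mapping_eqI)
    fix e :: "'g \<times> nat"
    obtain g i where e: "e = (g, i)" by fastforce
    show "Poly_Mapping.lookup (d (x \<otimes>\<^sub>k x)) e = Poly_Mapping.lookup
        ((- lam) *\<^sub>k (grp \<one> - grp a) - (dot.grp_coeff a * col.x_coeff a) *\<^sub>k x) e"
      using coeff[of e "(\<one>, 0)"] 2 unfolding e by (simp add: lookups algebra_simps split: if_splits)
  qed
qed

text \<open>
  Computing \<open>x \<cdot> xg = \<chi>(g) (x \<cdot> gx)\<close> on both sides gives \<open>c\<^sub>g \<lambda>(1 - a) = \<chi>(g) \<lambda>(1 - a)\<close>.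
\<close>

lemma dot_x_coeff [simp]:
  assumes g: "g \<in> carrier G"
  shows "dot.x_coeff g = \<chi> g"
proof -
  have "p (x \<otimes>\<^sub>k (x \<star>\<^bsub>H\<^esub> grp g)) = \<chi> g *\<^sub>k p (x \<otimes>\<^sub>k (grp g \<star>\<^bsub>H\<^esub> x))"
    using g by simp
  hence "p (p (x \<otimes>\<^sub>k grp g) \<otimes>\<^sub>k x) = \<chi> g *\<^sub>k p (p (x \<otimes>\<^sub>k x) \<otimes>\<^sub>k grp g)"
    using g by (simp only: dot.act_pmult gx_in_csp grp_in_csp one_closed)
  hence "(dot.x_coeff g * lam) *\<^sub>k (grp \<one> - grp a) = (\<chi> g * lam) *\<^sub>k (grp \<one> - grp a)"
    using g by (simp add: dot.x_act_grp x_dot_x)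
  from arg_cong[OF this, of "\<lambda>t. Poly_Mapping.lookup t (\<one>, 0)"]
  show ?thesis using lam by (simp add: lookup_minus lookup_grp)
qed

text \<open>
  The analogue for \<open>\<Colon>\<close>. Here \<open>x \<Colon> x\<close> may a priori have a component \<open>-\<nu>x\<close>; comparing the
  coefficients of \<open>x\<close> at \<open>g = a\<close> gives \<open>\<nu> = \<chi>(a)\<nu>\<close>, hence \<open>\<nu> = 0\<close>, and with it the formula.
\<close>

lemma col_x_coeff [simp]: "g \<in> carrier G \<Longrightarrow> col.x_coeff g = \<chi> g"
  and dot_grp_coeff_a: "dot.grp_coeff a = 0"
proof -
  let ?\<nu> = "dot.grp_coeff a * col.x_coeff a"
  have eq: "col.x_coeff g *\<^sub>k d (x \<otimes>\<^sub>k x) = \<chi> g *\<^sub>k d (d (x \<otimes>\<^sub>k x) \<otimes>\<^sub>k grp g)" if g: "g \<in> carrier G" for g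
  proof -
    have "d (x \<otimes>\<^sub>k (x \<star>\<^bsub>H\<^esub> grp g)) = \<chi> g *\<^sub>k d (x \<otimes>\<^sub>k (grp g \<star>\<^bsub>H\<^esub> x))"
      using g by simp
    hence "d (d (x \<otimes>\<^sub>k grp g) \<otimes>\<^sub>k x) = \<chi> g *\<^sub>k d (d (x \<otimes>\<^sub>k x) \<otimes>\<^sub>k grp g)"
      using g by (simp only: col.act_pmult gx_in_csp grp_in_csp one_closed)
    thus ?thesis using g by (simp add: col.x_act_grp)
  qed
  have \<nu>: "?\<nu> = 0"
    using arg_cong[OF eq[of a], of "\<lambda>t. Poly_Mapping.lookup t (\<one>, 1)"] chi_a col.x_coeff_nonzero[of a]
    by (simp add: compat_x_x col.x_act_grp lookup_add lookup_minus lookup_gx lookup_grp)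
  thus "dot.grp_coeff a = 0" using col.x_coeff_nonzero[of a] by simp
  show "col.x_coeff g = \<chi> g" if g: "g \<in> carrier G"
    using arg_cong[OF eq[OF g], of "\<lambda>t. Poly_Mapping.lookup t (\<one>, 0)"] g lam
    by (simp add: compat_x_x \<nu> lookup_add lookup_minus lookup_gx lookup_grp)
qed

lemma x_dot_grp [simp]: "g \<in> carrier G \<Longrightarrow> p (x \<otimes>\<^sub>k grp g) = \<chi> g *\<^sub>k x"
  and x_col_grp [simp]: "g \<in> carrier G \<Longrightarrow> d (x \<otimes>\<^sub>k grp g) = \<chi> g *\<^sub>k x"
  using dot.grp_coeff_eq_zero col.grp_coeff_eq_zero chi_a dot_grp_coeff_a compat_x_x(2)
  by (simp_all add: dot.x_act_grp col.x_act_grp)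

lemma x_col_x: "d (x \<otimes>\<^sub>k x) = (- lam) *\<^sub>k (grp \<one> - grp a)"
  using compat_x_x(3) by (simp add: dot_grp_coeff_a)

lemma grp_dot_gx [simp]: "h \<in> carrier G \<Longrightarrow> g \<in> carrier G \<Longrightarrow> p (grp h \<otimes>\<^sub>k gx g) = 0"
  and grp_col_gx [simp]: "h \<in> carrier G \<Longrightarrow> g \<in> carrier G \<Longrightarrow> d (grp h \<otimes>\<^sub>k gx g) = 0"
  using dot.act_pmult[of "grp h" "grp g" x] col.act_pmult[of "grp h" "grp g" x] by simp_all

lemma gx_dot_grp [simp]:
  "h \<in> carrier G \<Longrightarrow> g \<in> carrier G \<Longrightarrow> p (gx h \<otimes>\<^sub>k grp g) = \<chi> g *\<^sub>k gx (dot.grp_act h g)"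
  and gx_col_grp [simp]:
  "h \<in> carrier G \<Longrightarrow> g \<in> carrier G \<Longrightarrow> d (gx h \<otimes>\<^sub>k grp g) = \<chi> g *\<^sub>k gx (col.grp_act h g)"
  using pmult_dot[of "grp h" x "grp g"] pmult_col[of "grp h" x "grp g"] by simp_all

lemma grp_act_mult_a [simp]:
  assumes "h \<in> carrier G" "g \<in> carrier G"
  shows "dot.grp_act (h \<otimes> a) g = dot.grp_act h g \<otimes> a"
    and "col.grp_act (h \<otimes> a) g = col.grp_act h g \<otimes> a"
    and "dot.grp_act h (g \<otimes> a) = dot.grp_act h g" "col.grp_act h (g \<otimes> a) = col.grp_act h g"
  using pmult_dot[of "grp h" "grp a" "grp g"] pmult_col[of "grp h" "grp a" "grp g"] assms
  by (simp_all add: dot.grp_act_mult col.grp_act_mult)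

lemma gx_dot_gx [simp]:
  assumes h: "h \<in> carrier G" and g: "g \<in> carrier G"
  shows "p (gx h \<otimes>\<^sub>k gx g) = lam *\<^sub>k (grp (dot.grp_act h g) - grp (dot.grp_act h g \<otimes> a))"
proof -
  have "p (gx h \<otimes>\<^sub>k x) = lam *\<^sub>k (grp h - grp (h \<otimes> a))"
    using pmult_dot[of "grp h" x x] h by (simp add: x_dot_x x_col_x)
  thus ?thesis using dot.act_pmult[of "gx h" "grp g" x] h g by simp
qed

lemma gx_col_gx [simp]:
  assumes h: "h \<in> carrier G" and g: "g \<in> carrier G"
  shows "d (gx h \<otimes>\<^sub>k gx g) = (- lam) *\<^sub>k (grp (col.grp_act h g) - grp (col.grp_act h g \<otimes> a))"
proof -
  have "d (gx h \<otimes>\<^sub>k x) = (- lam) *\<^sub>k (grp h - grp (h \<otimes> a))"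
    using pmult_col[of "grp h" x x] h by (simp add: x_dot_x x_col_x)
  thus ?thesis using col.act_pmult[of "gx h" "grp g" x] h g by simp
qed

section \<open>The weak braiding operator\<close>

text \<open>
  The group elements \<open>h\<^sup>g\<close> and \<open>\<^sup>hg\<close>; the first is \<open>h \<cdot> g\<^sup>-\<^sup>1\<close> because \<open>G_bar\<close> maps \<open>k \<otimes> g\<close> to \<open>(k \<cdot> g) \<otimes> g\<close>.
\<close>

definition rgrp :: "'g \<Rightarrow> 'g \<Rightarrow> 'g" where
  "rgrp h g = dot.grp_act h (inv g)"

definition lgrp :: "'g \<Rightarrow> 'g \<Rightarrow> 'g" where
  "lgrp h g = col.grp_act g (rgrp h g)"

lemma rgrp_closed [simp]: "h \<in> carrier G \<Longrightarrow> g \<in> carrier G \<Longrightarrow> rgrp h g \<in> carrier G"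
  and lgrp_closed [simp]: "h \<in> carrier G \<Longrightarrow> g \<in> carrier G \<Longrightarrow> lgrp h g \<in> carrier G"
  by (simp_all add: rgrp_def lgrp_def)

lemma rgrp_act [simp]: "h \<in> carrier G \<Longrightarrow> g \<in> carrier G \<Longrightarrow> dot.grp_act (rgrp h g) g = h"
  by (simp add: rgrp_def dot.grp_act_inv)

lemma rgrp_mult_a [simp]:
  assumes "h \<in> carrier G" "g \<in> carrier G"
  shows "rgrp (h \<otimes> a) g = rgrp h g \<otimes> a" "rgrp h (g \<otimes> a) = rgrp h g"
proof -
  have "dot.grp_act k (inv a) = k" if "k \<in> carrier G" for k
    using dot.grp_act_inv(2)[of k a] that by simp
  thus "rgrp h (g \<otimes> a) = rgrp h g"
    using assms by (simp add: rgrp_def inv_mult_group dot.grp_act_mult)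
  show "rgrp (h \<otimes> a) g = rgrp h g \<otimes> a"
    using assms by (simp add: rgrp_def)
qed

lemma right_exp_eq:
  assumes "w \<in> HH" "G_bar p H w = u \<otimes>\<^sub>k v"
  shows "right_exp p H u v = tlift w (\<lambda>w1 w2. counit H w2 *\<^sub>k w1)"
proof -
  have "inj_on (G_bar p H) HH"
    using brace by (simp add: hopf_q_brace_def q_cycle_coalgebra_def left_regular_def bij_betw_def)
  hence "the_inv_into HH (G_bar p H) (u \<otimes>\<^sub>k v) = w"
    using assms by (intro the_inv_into_f_eq)
  thus ?thesis by (simp add: right_exp_def)
qed

lemma G_bar_linear [simp]:
  "G_bar p H (s + t) = G_bar p H s + G_bar p H t" "G_bar p H (c *\<^sub>k t) = c *\<^sub>k G_bar p H t"
  "G_bar p H (s - t) = G_bar p H s - G_bar p H t"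
  by (simp_all add: G_bar_def tlift_def)

lemma G_bar_low [simp]:
  assumes "h \<in> carrier G" "g \<in> carrier G"
  shows "G_bar p H (grp h \<otimes>\<^sub>k grp g) = grp (dot.grp_act h g) \<otimes>\<^sub>k grp g"
    "G_bar p H (gx h \<otimes>\<^sub>k grp g) = \<chi> g *\<^sub>k (gx (dot.grp_act h g) \<otimes>\<^sub>k grp g)"
    "G_bar p H (grp h \<otimes>\<^sub>k gx g) = grp (dot.grp_act h g) \<otimes>\<^sub>k gx g"
    "G_bar p H (gx h \<otimes>\<^sub>k gx g) =
      lam *\<^sub>k ((grp (dot.grp_act h g) - grp (dot.grp_act h g \<otimes> a)) \<otimes>\<^sub>k grp (g \<otimes> a)) +
      \<chi> g *\<^sub>k (gx (dot.grp_act h g) \<otimes>\<^sub>k gx g)"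
  using assms by (simp_all add: G_bar_def)

lemma right_exp_low [simp]:
  assumes "h \<in> carrier G" "g \<in> carrier G"
  shows "right_exp p H (grp h) (grp g) = grp (rgrp h g)"
    "right_exp p H (grp h) (gx g) = 0"
    "right_exp p H (gx h) (grp g) = inverse (\<chi> g) *\<^sub>k gx (rgrp h g)"
    "right_exp p H (gx h) (gx g) = (lam * inverse (\<chi> g)) *\<^sub>k (grp (rgrp h g \<otimes> a) - grp (rgrp h g))"
proof -
  let ?r = "rgrp h g" and ?c = "inverse (\<chi> g)"
  have \<chi>: "\<chi> g \<noteq> 0" using assms chi_nonzero by blast
  show "right_exp p H (grp h) (grp g) = grp ?r"
    by (subst right_exp_eq[of "grp ?r \<otimes>\<^sub>k grp g"]) (use assms in simp_all)
  show "right_exp p H (grp h) (gx g) = 0"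
    by (subst right_exp_eq[of "grp ?r \<otimes>\<^sub>k gx g"]) (use assms in simp_all)
  show "right_exp p H (gx h) (grp g) = ?c *\<^sub>k gx ?r"
    by (subst right_exp_eq[of "?c *\<^sub>k (gx ?r \<otimes>\<^sub>k grp g)"]) (use assms \<chi> in simp_all)
  \<comment> \<open>\<open>G_bar\<close> maps \<open>h\<^sup>gx \<otimes> gx\<close> to \<open>\<chi>(g) hx \<otimes> gx + \<lambda>h(1 - a) \<otimes> ga\<close>; the last two terms cancel the
    second summand.\<close>
  have "right_exp p H (gx h) (gx g) = tlift (?c *\<^sub>k (gx ?r \<otimes>\<^sub>k gx g) +
      (lam * ?c) *\<^sub>k (grp (?r \<otimes> a) \<otimes>\<^sub>k grp (g \<otimes> a)) + (- lam * ?c) *\<^sub>k (grp ?r \<otimes>\<^sub>k grp (g \<otimes> a)))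
      (\<lambda>w1 w2. counit H w2 *\<^sub>k w1)"
    by (rule right_exp_eq) (use assms \<chi> in \<open>auto intro!: poly_mapping_eqI simp: lookup_add lookup_minus algebra_simps\<close>)
  thus "right_exp p H (gx h) (gx g) = (lam * ?c) *\<^sub>k (grp (?r \<otimes> a) - grp ?r)"
    by (auto intro!: poly_mapping_eqI simp: lookup_add lookup_minus)
qed

text \<open>
  Since \<open>a\<close> acts trivially on \<open>G\<close>, the summand \<open>ga \<Colon> (hx)\<^sup>g\<^sup>x\<close> of \<open>\<^sup>h\<^sup>x(gx)\<close> is a multiple of
  \<open>(g \<Colon> h\<^sup>ga) - (g \<Colon> h\<^sup>g) = 0\<close>, and only \<open>gx \<Colon> (hx)\<^sup>g\<close> contributes.
\<close>

lemma left_exp_low [simp]: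
  assumes "h \<in> carrier G" "g \<in> carrier G"
  shows "left_exp p d H (grp h) (grp g) = grp (lgrp h g)"
    "left_exp p d H (grp h) (gx g) = \<chi> (rgrp h g) *\<^sub>k gx (lgrp h g)"
    "left_exp p d H (gx h) (grp g) = 0"
    "left_exp p d H (gx h) (gx g) = (lam * inverse (\<chi> g)) *\<^sub>k (grp (lgrp h g \<otimes> a) - grp (lgrp h g))"
  using assms
  by (auto intro!: poly_mapping_eqI simp: left_exp_def lgrp_def[symmetric] lookup_minus lookup_add algebra_simps)

lemma weak_braiding_low:
  assumes "h \<in> carrier G" "g \<in> carrier G"
  shows "weak_braiding p d H (grp h \<otimes>\<^sub>k gx g) = \<chi> (rgrp h g) *\<^sub>k (gx (lgrp h g) \<otimes>\<^sub>k grp (rgrp h g))"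
    "weak_braiding p d H (gx h \<otimes>\<^sub>k grp g) = inverse (\<chi> g) *\<^sub>k (grp (lgrp h g) \<otimes>\<^sub>k gx (rgrp h g))"
    "weak_braiding p d H (gx h \<otimes>\<^sub>k gx g) =
      (lam * inverse (\<chi> g)) *\<^sub>k (grp (lgrp h g) \<otimes>\<^sub>k (grp (rgrp h g \<otimes> a) - grp (rgrp h g))) +
      (\<chi> (rgrp h g) * inverse (\<chi> (g \<otimes> a))) *\<^sub>k (gx (lgrp h g) \<otimes>\<^sub>k gx (rgrp h g)) +
      (lam * inverse (\<chi> g)) *\<^sub>k ((grp (lgrp h g \<otimes> a) - grp (lgrp h g)) \<otimes>\<^sub>k grp (rgrp h g \<otimes> a))"
  using assms by (simp_all add: weak_braiding_def)

end

theorem mainTheorem9: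
  fixes G :: "('g, 'm) monoid_scheme"
    and \<chi> :: "'g \<Rightarrow> 'k::{alg_closed_field, field_char_0}"
    and a :: 'g and \<alpha> lam :: 'k
    and p d :: "(('g \<times> nat) \<times> ('g \<times> nat) \<Rightarrow>\<^sub>0 'k) \<Rightarrow> ('g \<times> nat \<Rightarrow>\<^sub>0 'k)"
  defines "H \<equiv> rank_one_hopf G \<chi> a \<alpha>"
    and "x \<equiv> gen_x G"
    and "s \<equiv> weak_braiding p d (rank_one_hopf G \<chi> a \<alpha>)"
    and "R \<equiv> \<lambda>h g. right_exp p (rank_one_hopf G \<chi> a \<alpha>) (grp h) (grp g)"
    and "L \<equiv> \<lambda>h g. left_exp p d (rank_one_hopf G \<chi> a \<alpha>) (grp h) (grp g)"
  assumes "datum G \<chi> a \<alpha>"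
    and "hopf_q_brace p d H"
    and "p (x \<otimes>\<^sub>k x) \<noteq> 0" and "d (x \<otimes>\<^sub>k x) \<noteq> 0"
    and "lam \<noteq> 0" and "p (x \<otimes>\<^sub>k x) = lam *\<^sub>k (unity H - grp a)"
  shows "\<forall>h\<in>carrier G. \<forall>g\<in>carrier G.
    s (grp h \<otimes>\<^sub>k (grp g \<star>\<^bsub>H\<^esub> x)) = \<chi> (grp_of G (R h g)) *\<^sub>k ((L h g \<star>\<^bsub>H\<^esub> x) \<otimes>\<^sub>k R h g) \<and>
    s ((grp h \<star>\<^bsub>H\<^esub> x) \<otimes>\<^sub>k grp g) = inverse (\<chi> g) *\<^sub>k (L h g \<otimes>\<^sub>k (R h g \<star>\<^bsub>H\<^esub> x)) \<and>
    s ((grp h \<star>\<^bsub>H\<^esub> x) \<otimes>\<^sub>k (grp g \<star>\<^bsub>H\<^esub> x)) =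
      (lam * inverse (\<chi> g)) *\<^sub>k (L h g \<otimes>\<^sub>k (R h g \<star>\<^bsub>H\<^esub> (grp a - unity H))) +
      (\<chi> (grp_of G (R h g)) * inverse (\<chi> (g \<otimes>\<^bsub>G\<^esub> a))) *\<^sub>k
        ((L h g \<star>\<^bsub>H\<^esub> x) \<otimes>\<^sub>k (R h g \<star>\<^bsub>H\<^esub> x)) +
      (lam * inverse (\<chi> g)) *\<^sub>k
        ((L h g \<star>\<^bsub>H\<^esub> (grp a - unity H)) \<otimes>\<^sub>k (R h g \<star>\<^bsub>H\<^esub> grp a))"
proof -
  interpret rank_one G \<chi> a \<alpha> by unfold_locales fact
  interpret rank_one_brace G \<chi> a \<alpha> p d lam
    by unfold_locales (use assms(7,10,11) in \<open>simp_all add: H_def x_def\<close>)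
  show ?thesis
    unfolding H_def x_def s_def R_def L_def by (simp add: weak_braiding_low)
qed

end
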